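(* Let $q$ be a nonzero complex number and $n\ge 1$. In the quantum matrix algebra $M_q(2n)$ put, for $1\le i<j\le 2n$, $$b'_{ij}=\sum_{m=1}^n\bigl(a_{i,2m-1}a_{j,2m}-q\,a_{j,2m-1}a_{i,2m}\bigr).$$ Then the quantum Pfaffian of $B'=(b'_{ij})$ equals the quantum determinant of $A=(a_{ij})_{1\le i,j\le 2n}$: $$\mathrm{Pf}_q(B')={\det}_q(A).$$
   Context: $M_q(N)$ is the unital associative complex algebra generated by $a_{ij}$, $1\le i,j\le N$, subject to the relations, for all $i<j$ and $k<l$: $a_{ik}a_{il}=qa_{il}a_{ik}$, $a_{ik}a_{jk}=qa_{jk}a_{ik}$, $a_{jk}a_{il}=a_{il}a_{jk}$, $a_{ik}a_{jl}-a_{jl}a_{ik}=(q-q^{-1})a_{il}a_{jk}$. The quantum determinant is ${\det}_q(A)=\sum_{\sigma\in S_N}(-q)^{l(\sigma)}a_{1,\sigma(1)}\cdots a_{N,\sigma(N)}$, with $l(\sigma)$ the number of inversions of $\sigma$. Quantum Pfaffian: given elements $c_{ij}$ ($1\le i<j\le 2n$) of an associative algebra, define $[s_1,\dots,s_{2p}]$ for $s_1<\cdots<s_{2p}$ in $\{1,\dots,2n\}$ inductively by $[i,j]=c_{ij}$ and $[s_1,\dots,s_{2p}]=\sum_{j=2}^{2p}(-q)^{j-2}[s_1,s_j]\,[s_2,\dots,\widehat{s_j},\dots,s_{2p}]$ for $p\ge2$ (hat means omitted). Then $\mathrm{Pf}_q((c_{ij}))=[1,2,\dots,2n]$. *)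

theory Defs
  imports
    Complex_Main
    "HOL-Library.Poly_Mapping"
    "HOL-Combinatorics.Permutations"
    "HOL-Algebra.QuotRing"
    "HOL-Algebra.Module"
begin

section \<open>Free algebras\<close>

datatype 'x fword = FWord (letters: "'x list")

text \<open>
  Words in letters \<^typ>\<open>'x\<close>, written additively so that \<^typ>\<open>'x fword \<Rightarrow>\<^sub>0 complex\<close> carries the
  convolution product of \<^theory>\<open>HOL-Library.Poly_Mapping\<close>: this is the monoid algebra of the free
  monoid, i.e. the free unital associative algebra.
\<close>

instantiation fword :: (type) monoid_add
begin

definition zero_fword :: "'a fword" where
  "0 = FWord []"

definition plus_fword :: "'a fword \<Rightarrow> 'a fword \<Rightarrow> 'a fword" where
  "u + v = FWord (letters u @ letters v)"

instance
  by standard (simp_all add: zero_fword_def plus_fword_def)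

end

type_synonym 'x ncpoly = "'x fword \<Rightarrow>\<^sub>0 complex"

definition free_alg :: "'x set \<Rightarrow> (complex, 'x ncpoly) module" where
  "free_alg X =
    \<lparr>carrier = {p. \<forall>w \<in> Poly_Mapping.keys p. set (letters w) \<subseteq> X},
     mult = (*), one = 1, zero = 0, add = (+),
     smult = (\<lambda>c. Poly_Mapping.map ((*) c))\<rparr>"

definition fgen :: "'x \<Rightarrow> 'x ncpoly" where
  "fgen x = Poly_Mapping.single (FWord [x]) 1"

text \<open>
  The library's \<^term>\<open>R Quot I\<close> forgets scalar multiplication; here it is kept, acting on cosets
  through representatives.
\<close>

definition quot_alg :: "(complex, 'b) module \<Rightarrow> 'b set \<Rightarrow> (complex, 'b set) module" where
  "quot_alg F I =
    ring.extend (F Quot I) (module.fields (\<lambda>c X. \<Union>x\<in>X. I +>\<^bsub>F\<^esub> (c \<odot>\<^bsub>F\<^esub> x)))"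


section \<open>The quantum matrix algebra\<close>

text \<open>
  Each relation is imposed for all values of the indices occurring in it. In particular the
  two $q$-commutation relations hold within every row and every column, the last ones included.
\<close>

definition qmat_rels :: "complex \<Rightarrow> nat \<Rightarrow> (nat \<times> nat) ncpoly set" where
  "qmat_rels q N =
    (let a = (\<lambda>i j. fgen (i, j)); s = (\<lambda>c. Poly_Mapping.map ((*) c)) in
      {a i k * a i l - s q (a i l * a i k) | i k l.
         i \<in> {1..N} \<and> k \<in> {1..N} \<and> l \<in> {1..N} \<and> k < l}
    \<union> {a i k * a j k - s q (a j k * a i k) | i j k.
         i \<in> {1..N} \<and> j \<in> {1..N} \<and> k \<in> {1..N} \<and> i < j}
    \<union> {a j k * a i l - a i l * a j k | i j k l.
         i \<in> {1..N} \<and> j \<in> {1..N} \<and> k \<in> {1..N} \<and> l \<in> {1..N} \<and> i < j \<and> k < l}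
    \<union> {a i k * a j l - a j l * a i k - s (q - inverse q) (a i l * a j k) | i j k l.
         i \<in> {1..N} \<and> j \<in> {1..N} \<and> k \<in> {1..N} \<and> l \<in> {1..N} \<and> i < j \<and> k < l})"

definition qmat_ideal :: "complex \<Rightarrow> nat \<Rightarrow> (nat \<times> nat) ncpoly set" where
  "qmat_ideal q N = Idl\<^bsub>free_alg ({1..N} \<times> {1..N})\<^esub> (qmat_rels q N)"

definition qmat_alg :: "complex \<Rightarrow> nat \<Rightarrow> (complex, (nat \<times> nat) ncpoly set) module" where
  "qmat_alg q N = quot_alg (free_alg ({1..N} \<times> {1..N})) (qmat_ideal q N)"

definition qmat_gen :: "complex \<Rightarrow> nat \<Rightarrow> nat \<Rightarrow> nat \<Rightarrow> (nat \<times> nat) ncpoly set" where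
  "qmat_gen q N i j = qmat_ideal q N +>\<^bsub>free_alg ({1..N} \<times> {1..N})\<^esub> fgen (i, j)"


section \<open>Quantum determinant and quantum Pfaffian\<close>

definition inversions :: "nat \<Rightarrow> (nat \<Rightarrow> nat) \<Rightarrow> (nat \<times> nat) set" where
  "inversions N \<sigma> = {(i, j). 1 \<le> i \<and> i < j \<and> j \<le> N \<and> \<sigma> j < \<sigma> i}"

definition qdet ::
  "(complex, 'b) module \<Rightarrow> complex \<Rightarrow> nat \<Rightarrow> (nat \<Rightarrow> nat \<Rightarrow> 'b) \<Rightarrow> 'b" where
  "qdet M q N a =
    (\<Oplus>\<^bsub>M\<^esub> \<sigma> \<in> {\<sigma>. \<sigma> permutes {1..N}}.
      (- q) ^ card (inversions N \<sigma>) \<odot>\<^bsub>M\<^esub>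
        foldr (\<otimes>\<^bsub>M\<^esub>) (map (\<lambda>i. a i (\<sigma> i)) [1..<Suc N]) \<one>\<^bsub>M\<^esub>)"

text \<open>
  The bracket $[s_1,\dots,s_{2p}]$. In the last equation \<open>s\<close> is $s_1$ and \<open>t ! k\<close> is $s_{k+2}$,
  so that \<open>k\<close> is $j-2$. The value on the empty list is a convention, and the values on lists of
  odd length are meaningless; neither is ever used for a list of positive even length.
\<close>

function qbracket ::
  "(complex, 'b) module \<Rightarrow> complex \<Rightarrow> (nat \<Rightarrow> nat \<Rightarrow> 'b) \<Rightarrow> nat list \<Rightarrow> 'b" where
  "qbracket M q c [] = \<one>\<^bsub>M\<^esub>"
| "qbracket M q c [i] = \<zero>\<^bsub>M\<^esub>"
| "qbracket M q c [i, j] = c i j"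
| "qbracket M q c (s # t1 # t2 # ts) =
    (let t = t1 # t2 # ts in
      \<Oplus>\<^bsub>M\<^esub> k \<in> {..<length t}.
        (- q) ^ k \<odot>\<^bsub>M\<^esub> (c s (t ! k) \<otimes>\<^bsub>M\<^esub> qbracket M q c (take k t @ drop (Suc k) t)))"
  by pat_completeness auto
termination
  by (relation "measure (\<lambda>(M, q, c, s). length s)") auto

definition qpfaffian ::
  "(complex, 'b) module \<Rightarrow> complex \<Rightarrow> nat \<Rightarrow> (nat \<Rightarrow> nat \<Rightarrow> 'b) \<Rightarrow> 'b" where
  "qpfaffian M q n c = qbracket M q c [1..<Suc (2 * n)]"

definition qmat_b' :: "complex \<Rightarrow> nat \<Rightarrow> nat \<Rightarrow> nat \<Rightarrow> (nat \<times> nat) ncpoly set" where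
  "qmat_b' q n i j =
    (let M = qmat_alg q (2 * n); a = qmat_gen q (2 * n) in
      \<Oplus>\<^bsub>M\<^esub> m \<in> {1..n}.
        a i (2 * m - 1) \<otimes>\<^bsub>M\<^esub> a j (2 * m)
        \<ominus>\<^bsub>M\<^esub> q \<odot>\<^bsub>M\<^esub> (a j (2 * m - 1) \<otimes>\<^bsub>M\<^esub> a i (2 * m)))"


section \<open>Well-definedness\<close>

text \<open>
  \<^const>\<open>genideal\<close>, \<^const>\<open>FactRing\<close> and \<^const>\<open>finsum\<close> take junk values outside rings, so we
  record that the structures above are rings, that the relations lie in the free algebra, and that
  scalar multiplication on the quotient is the induced one.
\<close>

lemma smult_ncpoly: "Poly_Mapping.map ((*) c) p = Poly_Mapping.single 0 c * (p :: 'x ncpoly)"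
  by (rule mult_map_scale_conv_mult)

lemma free_alg_simps [simp]:
  "mult (free_alg X) = (*)" "one (free_alg X) = 1" "zero (free_alg X) = 0"
  "add (free_alg X) = (+)" "smult (free_alg X) c = Poly_Mapping.map ((*) c)"
  by (simp_all add: free_alg_def)

lemma free_alg_carrier:
  "p \<in> carrier (free_alg X) \<longleftrightarrow> (\<forall>w \<in> Poly_Mapping.keys p. set (letters w) \<subseteq> X)"
  by (simp add: free_alg_def)

lemma free_alg_closed:
  assumes "p \<in> carrier (free_alg X)" "r \<in> carrier (free_alg X)"
  shows "p + r \<in> carrier (free_alg X)" "p - r \<in> carrier (free_alg X)"
    "p * r \<in> carrier (free_alg X)"
proof -
  show "p + r \<in> carrier (free_alg X)"
    using assms keys_add[of p r] unfolding free_alg_carrier by blast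
  show "p - r \<in> carrier (free_alg X)"
    using assms keys_diff[of p r] unfolding free_alg_carrier by blast
  show "p * r \<in> carrier (free_alg X)"
    unfolding free_alg_carrier
  proof
    fix w assume "w \<in> Poly_Mapping.keys (p * r)"
    then obtain u v where "w = u + v" "u \<in> Poly_Mapping.keys p" "v \<in> Poly_Mapping.keys r"
      using keys_mult[of p r] by blast
    then show "set (letters w) \<subseteq> X"
      using assms by (auto simp: free_alg_carrier plus_fword_def)
  qed
qed

lemma keys_smult: "Poly_Mapping.keys (Poly_Mapping.map ((*) c) p) \<subseteq> Poly_Mapping.keys (p :: 'x ncpoly)"
  by transfer auto

lemma free_alg_smult_closed:
  "p \<in> carrier (free_alg X) \<Longrightarrow> Poly_Mapping.map ((*) c) p \<in> carrier (free_alg X)"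
  unfolding free_alg_carrier using keys_smult by blast

lemma fgen_closed: "fgen x \<in> carrier (free_alg X) \<longleftrightarrow> x \<in> X"
  by (simp add: fgen_def free_alg_carrier)

lemma ring_free_alg: "ring (free_alg X)"
proof (rule ringI)
  show "abelian_group (free_alg X)"
  proof (rule abelian_groupI)
    fix p assume p: "p \<in> carrier (free_alg X)"
    have "- p \<in> carrier (free_alg X)"
      using p by (simp add: free_alg_carrier)
    then show "\<exists>r\<in>carrier (free_alg X). r \<oplus>\<^bsub>free_alg X\<^esub> p = \<zero>\<^bsub>free_alg X\<^esub>"
      by (auto intro!: bexI[of _ "- p"])
  qed (auto simp: free_alg_closed add_ac free_alg_carrier[of 0])
  show "monoid (free_alg X)"
    by (rule monoidI)
      (auto simp: free_alg_closed mult.assoc, simp add: free_alg_carrier zero_fword_def)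
qed (auto simp: distrib_left distrib_right)

lemma qmat_rels_subset: "qmat_rels q N \<subseteq> carrier (free_alg ({1..N} \<times> {1..N}))"
  unfolding qmat_rels_def Let_def by (auto intro!: free_alg_closed free_alg_smult_closed simp: fgen_closed)

lemma ideal_qmat_ideal: "ideal (qmat_ideal q N) (free_alg ({1..N} \<times> {1..N}))"
  unfolding qmat_ideal_def by (intro ring.genideal_ideal ring_free_alg qmat_rels_subset)

lemma quot_alg_simps [simp]:
  "carrier (quot_alg F I) = carrier (F Quot I)" "mult (quot_alg F I) = mult (F Quot I)"
  "one (quot_alg F I) = one (F Quot I)" "zero (quot_alg F I) = zero (F Quot I)"
  "add (quot_alg F I) = add (F Quot I)"
  "smult (quot_alg F I) c X = (\<Union>x\<in>X. I +>\<^bsub>F\<^esub> (c \<odot>\<^bsub>F\<^esub> x))"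
  by (simp_all add: quot_alg_def FactRing_def ring.defs module.defs)

lemma ring_quot_alg:
  assumes "ring (F Quot I)"
  shows "ring (quot_alg F I)"
proof -
  obtain Q where Q: "Q = F Quot I" by simp
  interpret Q: ring Q
    using assms by (simp add: Q)
  show ?thesis
    by (intro ringI abelian_groupI monoidI; unfold quot_alg_simps, fold Q)
      (auto simp: Q.a_ac Q.m_assoc Q.l_distr Q.r_distr intro: Q.l_neg Q.a_inv_closed)
qed

lemma ring_qmat_alg: "ring (qmat_alg q N)"
  unfolding qmat_alg_def by (intro ring_quot_alg ideal.quotient_is_ring[OF ideal_qmat_ideal])

lemma qmat_alg_smult_coset:
  fixes q :: complex and N :: nat
  defines "F \<equiv> free_alg ({1..N} \<times> {1..N})"
  assumes p: "p \<in> carrier F"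
  shows "c \<odot>\<^bsub>qmat_alg q N\<^esub> (qmat_ideal q N +>\<^bsub>F\<^esub> p) = qmat_ideal q N +>\<^bsub>F\<^esub> (c \<odot>\<^bsub>F\<^esub> p)"
proof -
  let ?I = "qmat_ideal q N"
  interpret I: ideal ?I F
    unfolding F_def by (rule ideal_qmat_ideal)
  have c1: "Poly_Mapping.single 0 c \<in> carrier F"
    by (simp add: F_def free_alg_carrier zero_fword_def)
  have *: "?I +>\<^bsub>F\<^esub> (c \<odot>\<^bsub>F\<^esub> x) = ?I +>\<^bsub>F\<^esub> (c \<odot>\<^bsub>F\<^esub> p)" if x: "x \<in> ?I +>\<^bsub>F\<^esub> p" for x
  proof -
    obtain h where h: "h \<in> ?I" "x = h \<oplus>\<^bsub>F\<^esub> p"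
      using x by (auto simp: a_r_coset_def r_coset_def)
    have "c \<odot>\<^bsub>F\<^esub> x = (Poly_Mapping.single 0 c \<otimes>\<^bsub>F\<^esub> h) \<oplus>\<^bsub>F\<^esub> (c \<odot>\<^bsub>F\<^esub> p)"
      by (simp add: h F_def smult_ncpoly distrib_left)
    moreover have "Poly_Mapping.single 0 c \<otimes>\<^bsub>F\<^esub> h \<in> ?I"
      by (rule I.I_l_closed[OF h(1) c1])
    ultimately have "c \<odot>\<^bsub>F\<^esub> x \<in> ?I +>\<^bsub>F\<^esub> (c \<odot>\<^bsub>F\<^esub> p)"
      by (auto simp: a_r_coset_def r_coset_def)
    moreover have "c \<odot>\<^bsub>F\<^esub> p \<in> carrier F"
      using p by (simp add: F_def free_alg_smult_closed)
    ultimately show ?thesis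
      using I.a_repr_independence[OF _ _ I.a_subgroup] by metis
  qed
  have "p \<in> ?I +>\<^bsub>F\<^esub> p"
    using p by (rule I.a_rcos_self)
  then have "(\<Union>x \<in> ?I +>\<^bsub>F\<^esub> p. ?I +>\<^bsub>F\<^esub> (c \<odot>\<^bsub>F\<^esub> x)) = ?I +>\<^bsub>F\<^esub> (c \<odot>\<^bsub>F\<^esub> p)"
    by (intro SUP_eq_const *) auto
  then show ?thesis
    unfolding qmat_alg_def F_def[symmetric] quot_alg_simps .
qed

end

theory Submission
  imports Defs "HOL-Combinatorics.Multiset_Permutations"
begin

text \<open>
  Call \<open>D S C\<close> the quantum minor with rows \<open>S\<close> and columns \<open>C\<close>, defined by expansion along its first row.
  The relations give an expansion along a column: $\sum_j (-q)^j a_{s_j,l} D(S - s_j, C)$ is $0$ if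
  $l \in C$ and a power of $-q$ times $D(S, C \cup \{l\})$ otherwise. Since
  $b'_{ij} = \sum_m (a_{i,2m-1} a_{j,2m} - q\, a_{i,2m} a_{j,2m-1})$, the sum over $j$ in the
  recursion for the bracket $[s_1, \dots, s_{2p}]$ is a column expansion, and the remaining factors
  $a_{s_1,2m-1}$, $a_{s_1,2m}$ reassemble into a first-row expansion. By induction,
  $[S] = \sum_M D(S, C_M)$, where $C_M = \bigcup_{m \in M} \{2m-1, 2m\}$ and $M \subseteq \{1, \dots, n\}$.
  For \<open>S = {1..2n}\<close> only $M = \{1, \dots, n\}$ contributes, and it gives the quantum determinant.
\<close>

section \<open>Ranks and inversions\<close>

text \<open>The exponent of \<open>- q\<close> attached to column \<open>l\<close> in a first-row
  expansion; \<open>l\<close> itself is never counted, whether or not it lies in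
  \<open>C\<close>.\<close>

definition below :: "nat set \<Rightarrow> nat \<Rightarrow> nat" where
  "below C l = card {d \<in> C. d < l}"

lemma below_insert:
  assumes "finite C" "l \<notin> C"
  shows "below (insert l C) c = below C c + (if l < c then 1 else 0)"
proof -
  have "{d \<in> insert l C. d < c} = (if l < c then insert l {d \<in> C. d < c} else {d \<in> C. d < c})"
    by auto
  then show ?thesis
    using assms by (simp add: below_def)
qed

lemma below_Suc: "finite C \<Longrightarrow> below C (Suc l) = below C l + (if l \<in> C then 1 else 0)"
proof -
  assume "finite C"
  have "{d \<in> C. d < Suc l} = (if l \<in> C then insert l {d \<in> C. d < l} else {d \<in> C. d < l})"
    by (auto simp: less_Suc_eq)
  then show ?thesis
    using \<open>finite C\<close> by (simp add: below_def)
qed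

text \<open>As \<open>c\<close> runs upwards through the elements of \<open>C\<close> below
  \<open>l\<close>, its rank takes the values 0, 1, 2 and so on, so the summands are consecutive
  differences of powers of \<open>x\<close> and telescope.\<close>

lemma sum_power_below:
  fixes x :: "'k::comm_ring_1"
  assumes "finite C"
  shows "(\<Sum>c \<in> {d \<in> C. d < l}. (x - 1) * x ^ below C c) = x ^ below C l - 1"
proof (induction l)
  case 0
  then show ?case by (simp add: below_def)
next
  case (Suc l)
  have "{d \<in> C. d < Suc l} = (if l \<in> C then insert l {d \<in> C. d < l} else {d \<in> C. d < l})"
    by (auto simp: less_Suc_eq)
  then show ?case
    using Suc assms by (simp add: below_Suc algebra_simps)
qed

section \<open>Inversions of permutations written as words\<close>

primrec list_inversions :: "nat list \<Rightarrow> nat" where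
  "list_inversions [] = 0"
| "list_inversions (x # xs) = below (set xs) x + list_inversions xs"

text \<open>Inversions are split by their first position, which contributes the number of smaller
  values to its right. Injectivity of \<open>\<sigma>\<close> lets positions be counted by values,
  as \<open>below\<close> does.\<close>

lemma card_inversions:
  assumes "inj \<sigma>"
  shows "card (inversions N \<sigma>) = list_inversions (map \<sigma> [1..<Suc N])"
proof -
  \<comment> \<open>\<open>J k\<close> keeps the inversions whose first position is at least
    \<open>k\<close>; the induction runs downwards from \<open>Suc N\<close>, where none is
    left.\<close>
  define J where "J k = {(i, j). k \<le> i \<and> i < j \<and> j \<le> N \<and> \<sigma> j < \<sigma> i}" for k
  have fin: "finite (J k)" for k
    by (rule finite_subset[of _ "{..N} \<times> {..N}"]) (auto simp: J_def)
  have "card (J k) = list_inversions (map \<sigma> [k..<Suc N])" if "k \<le> Suc N" for k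
    using that
  proof (induction rule: inc_induct)
    case base
    have "J (Suc N) = {}" by (auto simp: J_def)
    then show ?case by simp
  next
    case (step k)
    let ?K = "{j \<in> {Suc k..N}. \<sigma> j < \<sigma> k}"
    have "(i, j) \<in> J k \<longleftrightarrow> (i, j) \<in> Pair k ` ?K \<union> J (Suc k)" for i j
      by (cases "i = k") (auto simp: J_def)
    then have "J k = Pair k ` ?K \<union> J (Suc k)"
      by auto
    moreover have "Pair k ` ?K \<inter> J (Suc k) = {}"
      by (auto simp: J_def)
    ultimately have "card (J k) = card ?K + card (J (Suc k))"
      using fin[of "Suc k"] by (simp add: card_Un_disjoint card_image inj_on_def)
    also have "card ?K = below (\<sigma> ` {Suc k..N}) (\<sigma> k)"
    proof -
      have "{d \<in> \<sigma> ` {Suc k..N}. d < \<sigma> k} = \<sigma> ` ?K"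
        by auto
      then show ?thesis
        using assms by (simp add: below_def card_image inj_on_subset)
    qed
    finally show ?case
      using step by (simp add: upt_conv_Cons[of k] atLeastLessThanSuc_atLeastAtMost del: upt_Suc)
  qed
  moreover have "inversions N \<sigma> = J 1"
    by (auto simp: inversions_def J_def)
  ultimately show ?thesis by simp
qed

text \<open>Injectivity holds because a permutation of \<open>{1..N}\<close> is the identity
  elsewhere; surjectivity follows because the two finite sets have the same cardinality.\<close>

lemma bij_betw_permutes_permutations_of_set:
  "bij_betw (\<lambda>\<sigma>. map \<sigma> [1..<Suc N]) {\<sigma>. \<sigma> permutes {1..N}} (permutations_of_set {1..N})"
proof -
  let ?f = "\<lambda>\<sigma>. map \<sigma> [1..<Suc N]"
  let ?P = "{\<sigma>. \<sigma> permutes {1..N}}"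
  have upt: "set [1..<Suc N] = {1..N}"
    by auto
  have inj: "inj_on ?f ?P"
  proof (rule inj_onI, rule ext)
    fix \<sigma> \<tau> i assume *: "\<sigma> \<in> ?P" "\<tau> \<in> ?P" "?f \<sigma> = ?f \<tau>"
    then have "\<sigma> j = \<tau> j" if "j \<in> {1..N}" for j
      using that unfolding map_eq_conv upt by blast
    then show "\<sigma> i = \<tau> i"
      using * by (cases "i \<in> {1..N}") (auto simp: permutes_not_in)
  qed
  have sub: "?f ` ?P \<subseteq> permutations_of_set {1..N}"
  proof safe
    fix \<sigma> assume "\<sigma> permutes {1..N}"
    then show "?f \<sigma> \<in> permutations_of_set {1..N}"
      by (intro permutations_of_setI)
        (simp_all only: set_map upt permutes_image distinct_map distinct_upt permutes_inj_on simp_thms)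
  qed
  have "card (?f ` ?P) = card (permutations_of_set {1..N})"
    unfolding card_image[OF inj] by (subst card_permutations[of _ N]) simp_all
  then show ?thesis
    using inj sub card_subset_eq[OF _ sub] by (simp add: bij_betw_def)
qed

section \<open>Blocks of two adjacent columns\<close>

definition column_pairs :: "nat set \<Rightarrow> nat set" where
  "column_pairs M = (\<Union>m\<in>M. {2 * m - 1, 2 * m})"

lemma column_pairs_subset: "M \<subseteq> {1..n} \<Longrightarrow> 2 * n \<le> N \<Longrightarrow> column_pairs M \<subseteq> {1..N}"
  by (force simp: column_pairs_def)

lemma column_pairs_insert: "column_pairs (insert m M) = insert (2 * m - 1) (insert (2 * m) (column_pairs M))"
  by (simp add: column_pairs_def)

text \<open>Parity separates the entries \<open>2 * m - 1\<close> from the entries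
  \<open>2 * m\<close>; for positive indices the subtraction is not truncated.\<close>

lemma mem_column_pairs:
  assumes "m \<ge> 1" "0 \<notin> M"
  shows "2 * m \<in> column_pairs M \<longleftrightarrow> m \<in> M" "2 * m - 1 \<in> column_pairs M \<longleftrightarrow> m \<in> M"
proof -
  have "2 * m \<noteq> 2 * m' - 1" "2 * m - 1 \<noteq> 2 * m'" "2 * m - 1 = 2 * m' - 1 \<longleftrightarrow> m = m'"
    if "m' \<in> M" for m'
  proof -
    have "m' \<noteq> 0" using that assms by metis
    then show "2 * m \<noteq> 2 * m' - 1" "2 * m - 1 \<noteq> 2 * m'" "2 * m - 1 = 2 * m' - 1 \<longleftrightarrow> m = m'"
      using assms(1) by presburger+
  qed
  then show "2 * m \<in> column_pairs M \<longleftrightarrow> m \<in> M" "2 * m - 1 \<in> column_pairs M \<longleftrightarrow> m \<in> M"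
    by (auto simp: column_pairs_def)
qed

lemma column_pairs_atLeastAtMost: "column_pairs {1..n} = {1..2 * n}"
proof (induction n)
  case (Suc n)
  have "{1..Suc n} = insert (Suc n) {1..n}" by auto
  then show ?case
    using Suc by (auto simp: column_pairs_insert)
qed (simp add: column_pairs_def)

text \<open>Each new pair has two elements and is disjoint from the earlier ones. For the index 0
  truncated subtraction would collapse the pair to \<open>{0}\<close>.\<close>

lemma card_column_pairs:
  assumes "finite M" "0 \<notin> M"
  shows "card (column_pairs M) = 2 * card M"
  using assms
proof (induction M rule: finite_induct)
  case (insert m M)
  then have "2 * m \<notin> column_pairs M" "2 * m - 1 \<notin> column_pairs M" "2 * m - 1 \<noteq> 2 * m"
    using mem_column_pairs[of m M] by (cases m; auto)+
  moreover have "finite (column_pairs M)"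
    using insert by (simp add: column_pairs_def)
  ultimately show ?case
    using insert by (simp add: column_pairs_insert)
qed (simp add: column_pairs_def)

section \<open>Deleting a list entry\<close>

text \<open>Has the form that occurs in \<open>qbracket\<close>, so that the recursion there is a
  sum over \<open>omit k t\<close>.\<close>

definition omit :: "nat \<Rightarrow> 'b list \<Rightarrow> 'b list" where
  "omit k xs = take k xs @ drop (Suc k) xs"

lemma omit_Cons_0 [simp]: "omit 0 (x # xs) = xs"
  and omit_Cons_Suc [simp]: "omit (Suc k) (x # xs) = x # omit k xs"
  by (simp_all add: omit_def)

lemma set_omit: "set (omit k xs) \<subseteq> set xs"
  unfolding omit_def using set_take_subset set_drop_subset by fastforce

lemma length_omit: "k < length xs \<Longrightarrow> length (omit k xs) = length xs - 1"
  by (simp add: omit_def)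

lemma sorted_wrt_omit: "sorted_wrt P xs \<Longrightarrow> sorted_wrt P (omit k xs)"
proof (induction xs arbitrary: k)
  case Nil
  then show ?case by (simp add: omit_def)
next
  case (Cons x xs)
  then show ?case using set_omit by (cases k) force+
qed

section \<open>Quantum minors modulo the defining relations\<close>

text \<open>
  Equality in the quotient is expressed as congruence modulo \<open>I\<close>, so that sums and products are those
  of a type class. \<open>I\<close> is an ideal of the subring \<open>A\<close> only, hence the closure conditions.
\<close>

locale quantum_matrix =
  vector_space scale for scale :: "'k::field \<Rightarrow> 'a::ring_1 \<Rightarrow> 'a" (infixr "*s" 75) +
  fixes A I :: "'a set" and q :: 'k and N :: nat and a :: "nat \<Rightarrow> nat \<Rightarrow> 'a"
  assumes scale_mult_left: "(c *s x) * y = c *s (x * y)"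
    and scale_mult_right: "x * (c *s y) = c *s (x * y)"
    and zero_closed: "0 \<in> A" and one_closed: "1 \<in> A"
    and add_closed: "x \<in> A \<Longrightarrow> y \<in> A \<Longrightarrow> x + y \<in> A"
    and mult_closed: "x \<in> A \<Longrightarrow> y \<in> A \<Longrightarrow> x * y \<in> A"
    and scale_closed: "x \<in> A \<Longrightarrow> c *s x \<in> A"
    and zero_I: "0 \<in> I"
    and add_I: "x \<in> I \<Longrightarrow> y \<in> I \<Longrightarrow> x + y \<in> I"
    and mult_left_I: "x \<in> A \<Longrightarrow> y \<in> I \<Longrightarrow> x * y \<in> I"
    and mult_right_I: "x \<in> I \<Longrightarrow> y \<in> A \<Longrightarrow> x * y \<in> I"
    and q_nonzero: "q \<noteq> 0"
    and a_closed: "i \<in> {1..N} \<Longrightarrow> k \<in> {1..N} \<Longrightarrow> a i k \<in> A"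
    and column_relation: "\<lbrakk>i \<in> {1..N}; j \<in> {1..N}; k \<in> {1..N}; i < j\<rbrakk>
      \<Longrightarrow> a i k * a j k - q *s (a j k * a i k) \<in> I"
    and antidiagonal_relation: "\<lbrakk>i \<in> {1..N}; j \<in> {1..N}; k \<in> {1..N}; l \<in> {1..N}; i < j; k < l\<rbrakk>
      \<Longrightarrow> a j k * a i l - a i l * a j k \<in> I"
    and diagonal_relation: "\<lbrakk>i \<in> {1..N}; j \<in> {1..N}; k \<in> {1..N}; l \<in> {1..N}; i < j; k < l\<rbrakk>
      \<Longrightarrow> a i k * a j l - a j l * a i k - (q - inverse q) *s (a i l * a j k) \<in> I"
begin

section \<open>Congruence modulo the ideal\<close>

lemma sum_closed: "(\<And>x. x \<in> X \<Longrightarrow> f x \<in> A) \<Longrightarrow> sum f X \<in> A"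
  by (induction X rule: infinite_finite_induct) (auto simp: zero_closed add_closed)

text \<open>Scaling by \<open>c\<close> is left multiplication by \<open>c *s 1\<close>, an element
  of \<open>A\<close>.\<close>

lemma scale_I: "x \<in> I \<Longrightarrow> c *s x \<in> I"
  using mult_left_I[OF scale_closed[OF one_closed, of c], of x] by (simp add: scale_mult_left)

lemma minus_closed: "x \<in> A \<Longrightarrow> y \<in> A \<Longrightarrow> x - y \<in> A"
  using add_closed[OF _ scale_closed[of y "- 1"]] by (simp add: scale_minus_left)

definition eqv :: "'a \<Rightarrow> 'a \<Rightarrow> bool" (infix "\<approx>" 50) where
  "x \<approx> y \<longleftrightarrow> x - y \<in> I"

lemma eqv_refl [simp]: "x \<approx> x"
  by (simp add: eqv_def zero_I)

lemma eqv_sym: "x \<approx> y \<Longrightarrow> y \<approx> x"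
  unfolding eqv_def using scale_I[of "x - y" "- 1"] by (simp add: scale_minus_left)

lemma eqv_trans [trans]: "x \<approx> y \<Longrightarrow> y \<approx> z \<Longrightarrow> x \<approx> z"
  unfolding eqv_def using add_I[of "x - y" "y - z"] by simp

lemma eqv_add: "x \<approx> y \<Longrightarrow> x' \<approx> y' \<Longrightarrow> x + x' \<approx> y + y'"
  unfolding eqv_def using add_I[of "x - y" "x' - y'"] by (simp add: algebra_simps)

lemma eqv_scale: "x \<approx> y \<Longrightarrow> c *s x \<approx> c *s y"
  unfolding eqv_def using scale_I[of "x - y" c] by (simp add: scale_right_diff_distrib)

lemma eqv_diff: "x \<approx> y \<Longrightarrow> x' \<approx> y' \<Longrightarrow> x - x' \<approx> y - y'"
  using eqv_add[OF _ eqv_scale[of x' y' "- 1"]] by (simp add: scale_minus_left)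

lemma eqv_mult_left: "z \<in> A \<Longrightarrow> x \<approx> y \<Longrightarrow> z * x \<approx> z * y"
  unfolding eqv_def using mult_left_I[of z "x - y"] by (simp add: algebra_simps)

lemma eqv_mult_right: "z \<in> A \<Longrightarrow> x \<approx> y \<Longrightarrow> x * z \<approx> y * z"
  unfolding eqv_def using mult_right_I[of "x - y" z] by (simp add: algebra_simps)

lemma eqv_sum: "(\<And>x. x \<in> X \<Longrightarrow> f x \<approx> g x) \<Longrightarrow> sum f X \<approx> sum g X"
  by (induction X rule: infinite_finite_induct) (auto intro: eqv_add)

section \<open>Quantum minors by first-row expansion\<close>

text \<open>
  The value is \<open>0\<close> when the numbers of rows and columns differ, so that sums of minors need no
  restriction on the cardinality of the column set.
\<close>

primrec minor :: "nat list \<Rightarrow> nat set \<Rightarrow> 'a" where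
  "minor [] C = (if C = {} then 1 else 0)"
| "minor (s # S) C = (\<Sum>c\<in>C. (- q) ^ below C c *s (a s c * minor S (C - {c})))"

lemma minor_closed: "set S \<subseteq> {1..N} \<Longrightarrow> C \<subseteq> {1..N} \<Longrightarrow> minor S C \<in> A"
proof (induction S arbitrary: C)
  case (Cons s S)
  have "minor S (C - {c}) \<in> A" for c
    using Cons by (intro Cons.IH) auto
  moreover have "a s c \<in> A" if "c \<in> C" for c
    using Cons.prems that by (intro a_closed) auto
  ultimately show ?case
    by (simp add: sum_closed scale_closed mult_closed)
qed (simp add: zero_closed one_closed)

text \<open>Each expansion step removes one row and one column, so a mismatch of their numbers
  persists.\<close>

lemma minor_eq_0: "finite C \<Longrightarrow> card C \<noteq> length S \<Longrightarrow> minor S C = 0"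
proof (induction S arbitrary: C)
  case (Cons s S)
  have "minor S (C - {c}) = 0" if "c \<in> C" for c
    using Cons that card_Suc_Diff1[of C c] by (intro Cons.IH) auto
  then show ?case by simp
qed auto

section \<open>Expansion along a column\<close>

text \<open>Laplace expansion along column \<open>l\<close>, where \<open>C\<close> holds the
  columns of the complementary minors; \<open>l \<in> C\<close> is the case of a repeated column.
  Only the row position enters the exponent; the column position becomes a factor in
  \<open>column_expansion\<close>.\<close>

definition column_sum :: "nat list \<Rightarrow> nat \<Rightarrow> nat set \<Rightarrow> 'a" where
  "column_sum S l C = (\<Sum>j<length S. (- q) ^ j *s (a (S ! j) l * minor (omit j S) C))"

text \<open>The term of row \<open>s\<close> is set apart. In every other term \<open>s\<close> is
  the first row of the complementary minor, which is expanded along it. The products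
  \<open>a (S ! j) l * a s c\<close> then have row \<open>s\<close> on the wrong side for a
  first-row expansion.\<close>

lemma column_sum_Cons:
  "column_sum (s # S) l C = a s l * minor S C +
    (\<Sum>c\<in>C. (- q * (- q) ^ below C c) *s
      (\<Sum>j<length S. (- q) ^ j *s ((a (S ! j) l * a s c) * minor (omit j S) (C - {c}))))"
proof -
  have "column_sum (s # S) l C = a s l * minor S C +
    (\<Sum>j<length S. (- q) ^ Suc j *s (a (S ! j) l * minor (s # omit j S) C))"
    unfolding column_sum_def by (simp only: length_Cons sum.lessThan_Suc_shift) simp
  also have "(\<Sum>j<length S. (- q) ^ Suc j *s (a (S ! j) l * minor (s # omit j S) C)) =
    (\<Sum>j<length S. \<Sum>c\<in>C. ((- q) ^ Suc j * (- q) ^ below C c) *s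
       ((a (S ! j) l * a s c) * minor (omit j S) (C - {c})))"
    by (simp add: sum_distrib_left scale_sum_right scale_mult_right mult.assoc del: power_Suc)
  also have "\<dots> = (\<Sum>c\<in>C. \<Sum>j<length S. ((- q) ^ Suc j * (- q) ^ below C c) *s
       ((a (S ! j) l * a s c) * minor (omit j S) (C - {c})))"
    by (rule sum.swap)
  also have "\<dots> = (\<Sum>c\<in>C. (- q * (- q) ^ below C c) *s
      (\<Sum>j<length S. (- q) ^ j *s ((a (S ! j) l * a s c) * minor (omit j S) (C - {c}))))"
    by (simp add: scale_sum_right mult_ac)
  finally show ?thesis .
qed

text \<open>Two entries in different rows commute on an antidiagonal, commute up to a power of
  \<open>q\<close> in one column, and have on a diagonal a commutator in which the columns are
  exchanged.\<close>

lemma commute_past: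
  assumes "s \<in> {1..N}" "i \<in> {1..N}" "l \<in> {1..N}" "c \<in> {1..N}" "s < i"
  shows "l < c \<Longrightarrow> a i l * a s c \<approx> a s c * a i l"
    and "a i l * a s l \<approx> inverse q *s (a s l * a i l)"
    and "c < l \<Longrightarrow> a i l * a s c \<approx> a s c * a i l - (q - inverse q) *s (a s l * a i c)"
proof -
  show "a i l * a s c \<approx> a s c * a i l" if "l < c"
    using antidiagonal_relation[of s i l c] assms that by (simp add: eqv_def)
  have "inverse q *s (a s l * a i l) \<approx> inverse q *s (q *s (a i l * a s l))"
    using column_relation[of s i l] assms by (intro eqv_scale) (simp add: eqv_def)
  then show "a i l * a s l \<approx> inverse q *s (a s l * a i l)"
    using q_nonzero by (simp add: eqv_sym)
  show "a i l * a s c \<approx> a s c * a i l - (q - inverse q) *s (a s l * a i c)" if "c < l"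
    using diagonal_relation[of s i c l] assms that
    by (intro eqv_sym[of "a s c * a i l - _"]) (simp add: eqv_def algebra_simps)
qed

text \<open>The commutation rule depends only on \<open>l\<close>, \<open>c\<close> and
  \<open>s < S ! j\<close>, so it is the same in every term and the factor of row \<open>s\<close>
  leaves the sum. In the diagonal case the exchanged columns turn the correction into the column sum
  for \<open>c\<close>.\<close>

lemma row_commute_sum:
  assumes "sorted_wrt (<) (s # S)" "set (s # S) \<subseteq> {1..N}" "l \<in> {1..N}" "c \<in> {1..N}" "C \<subseteq> {1..N}"
  defines "X \<equiv> (\<Sum>j<length S. (- q) ^ j *s ((a (S ! j) l * a s c) * minor (omit j S) C))"
  shows "l < c \<Longrightarrow> X \<approx> a s c * column_sum S l C"
    and "c = l \<Longrightarrow> X \<approx> inverse q *s (a s l * column_sum S l C)"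
    and "c < l \<Longrightarrow> X \<approx> a s c * column_sum S l C - (q - inverse q) *s (a s l * column_sum S c C)"
proof -
  have S: "S ! j \<in> {1..N}" "s < S ! j" "minor (omit j S) C \<in> A" if "j < length S" for j
  proof -
    show "S ! j \<in> {1..N}" "s < S ! j" using assms that by (auto simp: subset_eq)
    show "minor (omit j S) C \<in> A" using assms set_omit[of j S] by (intro minor_closed) auto
  qed
  have s: "s \<in> {1..N}" using assms by simp
  note comm = commute_past[OF s S(1) assms(3,4) S(2)]
  show "X \<approx> a s c * column_sum S l C" if "l < c"
  proof -
    have "X \<approx> (\<Sum>j<length S. (- q) ^ j *s ((a s c * a (S ! j) l) * minor (omit j S) C))"
      unfolding X_def using that S comm(1) by (intro eqv_sum eqv_scale eqv_mult_right) auto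
    then show ?thesis
      by (simp add: column_sum_def sum_distrib_left scale_mult_right mult.assoc)
  qed
  show "X \<approx> inverse q *s (a s l * column_sum S l C)" if "c = l"
  proof -
    have "X \<approx> (\<Sum>j<length S. (- q) ^ j *s ((inverse q *s (a s l * a (S ! j) l)) * minor (omit j S) C))"
      unfolding X_def using that S comm(2) by (intro eqv_sum eqv_scale eqv_mult_right) auto
    then show ?thesis
      by (simp add: column_sum_def sum_distrib_left scale_mult_right scale_mult_left scale_sum_right
          mult.assoc mult.commute[of "inverse q"])
  qed
  show "X \<approx> a s c * column_sum S l C - (q - inverse q) *s (a s l * column_sum S c C)" if "c < l"
  proof -
    have "X \<approx> (\<Sum>j<length S. (- q) ^ j *s
        ((a s c * a (S ! j) l - (q - inverse q) *s (a s l * a (S ! j) c)) * minor (omit j S) C))"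
      unfolding X_def using that S comm(3) by (intro eqv_sum eqv_scale eqv_mult_right) auto
    moreover have "(\<Sum>j<length S. (- q) ^ j *s ((a s c * a (S ! j) l - u *s (a s l * a (S ! j) c))
        * minor (omit j S) C)) = a s c * column_sum S l C - u *s (a s l * column_sum S c C)" for u
      by (simp add: column_sum_def sum_distrib_left scale_mult_right scale_mult_left scale_sum_right
          mult.assoc left_diff_distrib scale_right_diff_distrib sum_subtractf mult.commute[of u])
    ultimately show ?thesis by simp
  qed
qed

text \<open>Induction on the rows: in \<open>column_sum_Cons\<close> the factors of row
  \<open>s\<close> are moved to the left and the hypothesis is applied to the columns
  \<open>C - {c}\<close>. The result is a scaled first-row expansion of the target minor outside
  column \<open>l\<close>, absent if \<open>l \<in> C\<close>, plus multiples of
  \<open>a s l * minor S C\<close>. These multiples add up to 0 if \<open>l \<in> C\<close> and to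
  the missing term of column \<open>l\<close> otherwise.\<close>

lemma column_expansion:
  assumes "sorted_wrt (<) S" "set S \<subseteq> {1..N}" "l \<in> {1..N}" "C \<subseteq> {1..N}"
  shows "column_sum S l C \<approx> (if l \<in> C then 0 else (- q) ^ below C l *s minor S (insert l C))"
  using assms
proof (induction S arbitrary: l C)
  case Nil
  then show ?case by (simp add: column_sum_def)
next
  case (Cons s S)
  have fin: "finite C" using Cons.prems(4) finite_subset by blast
  have IH: "column_sum S l C \<approx> (if l \<in> C then 0 else (- q) ^ below C l *s minor S (insert l C))"
    if "l \<in> {1..N}" "C \<subseteq> {1..N}" for l C
    using Cons that by simp
  define X where "X c = (\<Sum>j<length S. (- q) ^ j *s
      ((a (S ! j) l * a s c) * minor (omit j S) (C - {c})))" for c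
  have as: "a s c \<in> A" if "c \<in> {1..N}" for c
    using that Cons.prems by (intro a_closed) auto
  have X: "l < c \<Longrightarrow> X c \<approx> a s c * column_sum S l (C - {c})"
    "c = l \<Longrightarrow> X c \<approx> inverse q *s (a s l * column_sum S l (C - {c}))"
    "c < l \<Longrightarrow> X c \<approx> a s c * column_sum S l (C - {c}) - (q - inverse q) *s (a s l * column_sum S c (C - {c}))"
    if "c \<in> C" for c
    unfolding X_def using row_commute_sum[OF Cons.prems(1-3), of c "C - {c}"] that Cons.prems(4)
    by blast+
  let ?T = "below C l"
  \<comment> \<open>\<open>h c\<close> collects the multiples of \<open>a s l * minor S C\<close> that arise from moving \<open>a s c\<close> to the left;
    by \<open>sum_power_below\<close> they telescope.\<close>
  define h where "h c = (if c < l then (q\<^sup>2 - 1) * (q\<^sup>2) ^ below C c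
    else if c = l then - ((q\<^sup>2) ^ ?T) else 0)" for c
  have below_remove: "below C d = below (C - {c}) d + (if c < d then 1 else 0)" if "c \<in> C" for c d
    using below_insert[of "C - {c}" c d] fin that by (simp add: insert_absorb)
  \<comment> \<open>The elements below \<open>l\<close> telescope to
    \<open>(q\<^sup>2) ^ ?T - 1\<close>, whose \<open>- 1\<close> cancels the term of row
    \<open>s\<close> set apart in \<open>column_sum_Cons\<close>. If \<open>l \<in> C\<close>, the
    element \<open>l\<close> removes the power as well.\<close>
  have sum_h: "(\<Sum>c\<in>C. h c) = (q\<^sup>2) ^ ?T - 1 - (if l \<in> C then (q\<^sup>2) ^ ?T else 0)"
  proof -
    have "(\<Sum>c\<in>C. h c) = (\<Sum>c\<in>C. if c < l then (q\<^sup>2 - 1) * (q\<^sup>2) ^ below C c else 0)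
        + (\<Sum>c\<in>C. if c = l then - ((q\<^sup>2) ^ ?T) else 0)"
      unfolding sum.distrib[symmetric] h_def by (intro sum.cong) auto
    also have "(\<Sum>c\<in>C. if c < l then (q\<^sup>2 - 1) * (q\<^sup>2) ^ below C c else 0) = (q\<^sup>2) ^ ?T - 1"
      using sum_power_below[OF fin, of "q\<^sup>2" l]
      by (subst sum.inter_filter[OF fin, symmetric]) simp
    finally show ?thesis using fin by (simp add: sum.delta)
  qed
  have sq: "(- q) ^ k * (- q) ^ k = (q\<^sup>2) ^ k" for k
    by (simp add: power_mult_distrib[symmetric] power2_eq_square)
  have sq_inverse: "q * (- q) ^ k * (inverse q * (- q) ^ k) = (q\<^sup>2) ^ k" for k
    using q_nonzero by (simp add: sq[symmetric])
  let ?m = "a s l * minor S C"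
  \<comment> \<open>For \<open>l \<notin> C\<close> this is the term of column \<open>c\<close> in
    \<open>(- q) ^ ?T *s minor (s # S) (insert l C)\<close>.\<close>
  define r where "r c = (if l \<in> C then 0 else ((- q) ^ ?T * (- q) ^ below (insert l C) c) *s
    (a s c * minor S (insert l C - {c})))" for c
  have step: "(- q * (- q) ^ below C c) *s X c \<approx> r c + h c *s ?m" if c: "c \<in> C" for c
  proof -
    have cN: "c \<in> {1..N}" using c Cons.prems(4) by auto
    have CN: "C - {c} \<subseteq> {1..N}" using Cons.prems(4) by auto
    note col_l = eqv_mult_left[OF as[OF cN] IH[OF Cons.prems(3) CN]]
    note col_c = eqv_mult_left[OF as[OF Cons.prems(3)] IH[OF cN CN]]
    consider "l < c" | "c = l" | "c < l" by linarith
    then show ?thesis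
    proof cases
      \<comment> \<open>Inserting \<open>l\<close> raises the rank of \<open>c\<close> by one, which
        absorbs the factor \<open>- q\<close>; removing \<open>c\<close> leaves the rank of
        \<open>l\<close> unchanged.\<close>
      case 1
      have "X c \<approx> a s c * (if l \<in> C - {c} then 0 else (- q) ^ below (C - {c}) l *s minor S (insert l (C - {c})))"
        using eqv_trans[OF X(1)[OF c 1] col_l] .
      note eqv_scale[OF this, of "- q * (- q) ^ below C c"]
      also have "(- q * (- q) ^ below C c) *s (a s c * (if l \<in> C - {c} then 0 else (- q) ^ below (C - {c}) l *s minor S (insert l (C - {c})))) = r c + h c *s ?m"
        using 1 c below_remove[OF c, of l] fin
        by (auto simp: r_def h_def below_insert insert_Diff_if scale_mult_right mult_ac)
      finally show ?thesis .
    next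
      \<comment> \<open>The hypothesis reinserts the removed column \<open>l\<close>, giving
        \<open>minor S C\<close>; the factors \<open>- q\<close> and \<open>inverse q\<close> leave
        only a sign.\<close>
      case 2
      have "X c \<approx> inverse q *s (a s l * (if l \<in> C - {c} then 0 else (- q) ^ below (C - {c}) l *s minor S (insert l (C - {c}))))"
        by (rule eqv_trans[OF X(2)[OF c 2] eqv_scale[OF eqv_mult_left[OF as[OF Cons.prems(3)]
            IH[OF Cons.prems(3) CN]]]])
      note eqv_scale[OF this, of "- q * (- q) ^ below C c"]
      also have "(- q * (- q) ^ below C c) *s inverse q *s (a s l * (if l \<in> C - {c} then 0 else (- q) ^ below (C - {c}) l *s minor S (insert l (C - {c})))) = r c + h c *s ?m"
        using 2 c below_remove[OF c, of l]
        by (auto simp: r_def h_def insert_absorb scale_mult_right sq_inverse)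
      finally show ?thesis .
    next
      \<comment> \<open>Removing \<open>c\<close> lowers the rank of \<open>l\<close> by one, and
        the factor \<open>- q\<close> makes up for it. The correction reinserts \<open>c\<close> and
        so contributes to \<open>a s l * minor S C\<close>.\<close>
      case 3
      have "X c \<approx> a s c * (if l \<in> C - {c} then 0 else (- q) ^ below (C - {c}) l *s minor S (insert l (C - {c})))
        - (q - inverse q) *s (a s l * (if c \<in> C - {c} then 0 else (- q) ^ below (C - {c}) c *s minor S (insert c (C - {c}))))"
        by (rule eqv_trans[OF X(3)[OF c 3] eqv_diff[OF col_l eqv_scale[OF col_c]]])
      note eqv_scale[OF this, of "- q * (- q) ^ below C c"]
      also have "(- q * (- q) ^ below C c) *s (a s c * (if l \<in> C - {c} then 0 else (- q) ^ below (C - {c}) l *s minor S (insert l (C - {c})))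
        - (q - inverse q) *s (a s l * (if c \<in> C - {c} then 0 else (- q) ^ below (C - {c}) c *s minor S (insert c (C - {c}))))) = r c + h c *s ?m"
      proof -
        have 31: "(- q * (- q) ^ below C c) *s (a s c * (if l \<in> C - {c} then 0 else (- q) ^ below (C - {c}) l *s minor S (insert l (C - {c})))) = r c"
          using 3 c below_remove[OF c, of l] fin
          by (auto simp: r_def below_insert insert_Diff_if scale_mult_right mult_ac)
        have "- q * x * ((q - inverse q) * x) = - ((q\<^sup>2 - 1) * (x * x))" for x
          using q_nonzero by (simp add: field_simps power2_eq_square)
        then have "- q * (- q) ^ below C c * ((q - inverse q) * (- q) ^ below C c) = - h c"
          using 3 by (simp only: h_def sq if_True)
        then have 32: "(- q * (- q) ^ below C c) *s (q - inverse q) *s (a s l * (if c \<in> C - {c} then 0 else (- q) ^ below (C - {c}) c *s minor S (insert c (C - {c})))) = - (h c *s ?m)"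
          using 3 c below_remove[OF c, of c]
          by (simp add: insert_absorb scale_mult_right mult.assoc)
        show ?thesis
          unfolding scale_right_diff_distrib 31 32 by simp
      qed
      finally show ?thesis .
    qed
  qed
  have "column_sum (s # S) l C \<approx> ?m + (\<Sum>c\<in>C. r c + h c *s ?m)"
    unfolding column_sum_Cons X_def[symmetric] by (intro eqv_add eqv_refl eqv_sum step)
  also have "?m + (\<Sum>c\<in>C. r c + h c *s ?m) = (1 + (\<Sum>c\<in>C. h c)) *s ?m + (\<Sum>c\<in>C. r c)"
    by (simp add: sum.distrib scale_left_distrib scale_sum_left)
  also have "\<dots> = (if l \<in> C then 0 else (- q) ^ ?T *s minor (s # S) (insert l C))"
  proof (cases "l \<in> C")
    case True
    then show ?thesis by (simp add: sum_h r_def)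
  next
    case False
    then show ?thesis
      using fin by (simp add: sum_h r_def scale_right_distrib scale_sum_right sq below_insert)
  qed
  finally show ?case .
qed

section \<open>Minors as sums over permutations\<close>

text \<open>The first-row expansion is iterated: words are grouped by their first letter
  \<open>c\<close>, which forms \<open>below C c\<close> inversions with the later letters.\<close>

lemma minor_eq_sum_permutations:
  assumes "finite C" "length S = card C"
  shows "minor S C =
    (\<Sum>xs\<in>permutations_of_set C. (- q) ^ list_inversions xs *s prod_list (map2 a S xs))"
  using assms
proof (induction S arbitrary: C)
  case Nil
  then show ?case by simp
next
  case (Cons s S)
  have "C \<noteq> {}" using Cons.prems(2) by (metis card.empty length_0_conv list.distinct(1))
  then have "(\<Sum>xs\<in>permutations_of_set C. (- q) ^ list_inversions xs *s prod_list (map2 a (s # S) xs))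
    = (\<Sum>c\<in>C. \<Sum>xs\<in>(#) c ` permutations_of_set (C - {c}).
        (- q) ^ list_inversions xs *s prod_list (map2 a (s # S) xs))"
    unfolding permutations_of_set_nonempty[OF \<open>C \<noteq> {}\<close>] using Cons.prems(1)
    by (intro sum.UNION_disjoint) auto
  also have "\<dots> = (\<Sum>c\<in>C. \<Sum>xs\<in>permutations_of_set (C - {c}).
        (- q) ^ list_inversions (c # xs) *s prod_list (map2 a (s # S) (c # xs)))"
    by (simp add: sum.reindex)
  also have "\<dots> = (\<Sum>c\<in>C. (- q) ^ below C c *s (a s c * minor S (C - {c})))"
  proof (rule sum.cong[OF refl])
    fix c assume c: "c \<in> C"
    have below: "below (C - {c}) c = below C c"
      using below_insert[of "C - {c}" c c] Cons.prems c by (simp add: insert_absorb)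
    have "(\<Sum>xs\<in>permutations_of_set (C - {c}).
        (- q) ^ list_inversions (c # xs) *s prod_list (map2 a (s # S) (c # xs))) =
      (\<Sum>xs\<in>permutations_of_set (C - {c}).
        (- q) ^ below C c *s (a s c * ((- q) ^ list_inversions xs *s prod_list (map2 a S xs))))"
      by (intro sum.cong refl) (simp add: permutations_of_setD(1) below power_add scale_mult_right)
    also have "\<dots> = (- q) ^ below C c *s (a s c * minor S (C - {c}))"
      using Cons.IH[of "C - {c}"] Cons.prems c by (simp add: sum_distrib_left scale_sum_right)
    finally show "(\<Sum>xs\<in>permutations_of_set (C - {c}).
        (- q) ^ list_inversions (c # xs) *s prod_list (map2 a (s # S) (c # xs))) =
        (- q) ^ below C c *s (a s c * minor S (C - {c}))" .
  qed
  finally show ?case by simp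
qed

text \<open>Reindexing the words by permutations gives the summands of \<open>qdet\<close>.\<close>

lemma minor_eq_sum_permutes:
  "minor [1..<Suc k] {1..k} = (\<Sum>\<sigma> | \<sigma> permutes {1..k}.
    (- q) ^ card (inversions k \<sigma>) *s prod_list (map (\<lambda>i. a i (\<sigma> i)) [1..<Suc k]))"
proof -
  have "map2 a xs (map \<sigma> xs) = map (\<lambda>i. a i (\<sigma> i)) xs" for \<sigma> xs
    by (induction xs) auto
  then have "minor [1..<Suc k] {1..k} = (\<Sum>\<sigma> | \<sigma> permutes {1..k}.
    (- q) ^ list_inversions (map \<sigma> [1..<Suc k]) *s prod_list (map (\<lambda>i. a i (\<sigma> i)) [1..<Suc k]))"
    by (subst minor_eq_sum_permutations)
      (simp_all only: sum.reindex_bij_betw[OF bij_betw_permutes_permutations_of_set, symmetric]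
        finite_atLeastAtMost length_upt card_atLeastAtMost diff_Suc_1)
  also have "\<dots> = (\<Sum>\<sigma> | \<sigma> permutes {1..k}.
    (- q) ^ card (inversions k \<sigma>) *s prod_list (map (\<lambda>i. a i (\<sigma> i)) [1..<Suc k]))"
  proof (rule sum.cong[OF refl])
    fix \<sigma> assume "\<sigma> \<in> {\<sigma>. \<sigma> permutes {1..k}}"
    then have "inj \<sigma>" by (simp only: mem_Collect_eq permutes_inj)
    then show "(- q) ^ list_inversions (map \<sigma> [1..<Suc k]) *s prod_list (map (\<lambda>i. a i (\<sigma> i)) [1..<Suc k])
      = (- q) ^ card (inversions k \<sigma>) *s prod_list (map (\<lambda>i. a i (\<sigma> i)) [1..<Suc k])"
      by (simp only: card_inversions)
  qed
  finally show ?thesis .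
qed

section \<open>The Pfaffian recursion for sums of minors\<close>

text \<open>Represents \<open>qmat_b'\<close> before the passage to the quotient, with the same
  order of factors.\<close>

definition pair_minor_sum :: "nat \<Rightarrow> nat \<Rightarrow> nat \<Rightarrow> 'a" where
  "pair_minor_sum n i j =
    (\<Sum>m = 1..n. a i (2 * m - 1) * a j (2 * m) - q *s (a j (2 * m - 1) * a i (2 * m)))"

lemma pair_minor_sum_closed:
  assumes "2 * n \<le> N" "i \<in> {1..N}" "j \<in> {1..N}"
  shows "pair_minor_sum n i j \<in> A"
  unfolding pair_minor_sum_def using assms
  by (intro sum_closed minus_closed scale_closed mult_closed a_closed) auto

text \<open>For \<open>i < j\<close> the factors of the second product lie on an antidiagonal and
  commute. With row \<open>i\<close> first, each summand is a quantum minor with two rows, ready for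
  a first-row expansion.\<close>

lemma pair_minor_sum_eqv:
  assumes "2 * n \<le> N" "i \<in> {1..N}" "j \<in> {1..N}" "i < j"
  shows "pair_minor_sum n i j \<approx>
    (\<Sum>m = 1..n. a i (2 * m - 1) * a j (2 * m) - q *s (a i (2 * m) * a j (2 * m - 1)))"
  unfolding pair_minor_sum_def
proof (intro eqv_sum eqv_diff eqv_scale eqv_refl)
  fix m assume "m \<in> {1..n}"
  then show "a j (2 * m - 1) * a i (2 * m) \<approx> a i (2 * m) * a j (2 * m - 1)"
    unfolding eqv_def using assms by (intro antidiagonal_relation) auto
qed

text \<open>By \<open>column_expansion\<close> both column sums vanish if \<open>m \<in> M\<close>.
  Otherwise each inserts one column of the pair, and the factor of row \<open>s\<close> supplies the
  other; together they are the part of a first-row expansion that belongs to this pair.\<close>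

lemma pair_column_expansion:
  fixes m s n :: nat and t :: "nat list" and M :: "nat set"
  assumes n: "2 * n \<le> N" and t: "sorted_wrt (<) t" "set t \<subseteq> {1..N}" and s: "s \<in> {1..N}"
    and M: "M \<subseteq> {1..n}" and m: "m \<in> {1..n}"
  defines "C \<equiv> column_pairs (insert m M)"
  shows "a s (2 * m - 1) * column_sum t (2 * m) (column_pairs M)
      - q *s (a s (2 * m) * column_sum t (2 * m - 1) (column_pairs M))
    \<approx> (if m \<in> M then 0
        else \<Sum>x\<in>{2 * m - 1, 2 * m}. (- q) ^ below C x *s (a s x * minor t (C - {x})))"
proof -
  let ?D = "column_pairs M"
  have mN: "2 * m - 1 \<in> {1..N}" "2 * m \<in> {1..N}" using m n by auto
  have D: "?D \<subseteq> {1..N}" using M n by (rule column_pairs_subset)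
  have mem: "2 * m \<in> ?D \<longleftrightarrow> m \<in> M" "2 * m - 1 \<in> ?D \<longleftrightarrow> m \<in> M"
    using mem_column_pairs[of m M] m M by fastforce+
  have exp: "a s x * column_sum t l ?D \<approx>
      a s x * (if l \<in> ?D then 0 else (- q) ^ below ?D l *s minor t (insert l ?D))"
    if "x \<in> {1..N}" "l \<in> {1..N}" for x l
    using that s by (intro eqv_mult_left a_closed column_expansion t D)
  have "a s (2 * m - 1) * column_sum t (2 * m) ?D - q *s (a s (2 * m) * column_sum t (2 * m - 1) ?D)
    \<approx> a s (2 * m - 1) * (if 2 * m \<in> ?D then 0 else (- q) ^ below ?D (2 * m) *s minor t (insert (2 * m) ?D))
      - q *s (a s (2 * m) * (if 2 * m - 1 \<in> ?D then 0
          else (- q) ^ below ?D (2 * m - 1) *s minor t (insert (2 * m - 1) ?D)))"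
    by (intro eqv_diff eqv_scale exp mN)
  also have "\<dots> = (if m \<in> M then 0
        else \<Sum>x\<in>{2 * m - 1, 2 * m}. (- q) ^ below C x *s (a s x * minor t (C - {x})))"
  proof (cases "m \<in> M")
    case True
    then show ?thesis using mem by simp
  next
    case False
    have fin: "finite ?D" using D finite_subset by blast
    define k l where "k = 2 * m - 1" and "l = 2 * m"
    then have kl: "l = Suc k" "k \<notin> ?D" "l \<notin> ?D"
      using m False mem by simp_all
    have C: "C = insert k (insert l ?D)"
      by (simp add: C_def column_pairs_insert k_def l_def)
    \<comment> \<open>Since \<open>k \<notin> ?D\<close>, the adjacent columns \<open>k\<close> and
      \<open>l\<close> have the same rank in \<open>?D\<close>. In \<open>C\<close> the rank of
      \<open>l\<close> is one larger because of \<open>k\<close>, which accounts for the coefficient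
      \<open>- q\<close>.\<close>
    have "below ?D l = below ?D k"
      using below_Suc[OF fin, of k] kl by simp
    moreover have "below C k = below ?D k" "below C l = Suc (below ?D l)"
      using fin kl by (simp_all add: C below_insert)
    moreover have "C - {k} = insert l ?D" "C - {l} = insert k ?D"
      using kl by (auto simp: C)
    ultimately show ?thesis
      unfolding k_def[symmetric] l_def[symmetric] using False kl by (simp add: scale_mult_right)
  qed
  finally show ?thesis .
qed

text \<open>The pairs partition the column set, so this is the first-row expansion with its terms
  grouped by pairs.\<close>

lemma sum_pairs_row_expansion:
  assumes "M \<subseteq> {1..n}"
  shows "(\<Sum>m\<in>M. \<Sum>x\<in>{2 * m - 1, 2 * m}.
      (- q) ^ below (column_pairs M) x *s (a s x * minor t (column_pairs M - {x})))
    = minor (s # t) (column_pairs M)"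
proof -
  have disj: "{2 * i - 1, 2 * i} \<inter> {2 * j - 1, 2 * j} = {}" if "i \<in> M" "j \<in> M" "i \<noteq> j" for i j
  proof -
    have "i \<ge> 1" "j \<ge> 1" using that assms by auto
    then have "2 * i - 1 \<noteq> 2 * j" "2 * i \<noteq> 2 * j - 1" "2 * i - 1 \<noteq> 2 * j - 1" "2 * i \<noteq> 2 * j"
      using \<open>i \<noteq> j\<close> by presburger+
    then show ?thesis by blast
  qed
  have "finite M" using assms finite_subset by blast
  then have "sum g (column_pairs M) = (\<Sum>m\<in>M. \<Sum>x\<in>{2 * m - 1, 2 * m}. g x)" for g :: "nat \<Rightarrow> 'a"
    unfolding column_pairs_def using disj by (intro sum.UNION_disjoint ballI impI) simp_all
  then show ?thesis by simp
qed

lemma pfaffian_step: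
  assumes n: "2 * n \<le> N" and st: "sorted_wrt (<) (s # t)" "set (s # t) \<subseteq> {1..N}"
  shows "(\<Sum>k<length t. (- q) ^ k *s (pair_minor_sum n s (t ! k) *
      (\<Sum>M\<in>Pow {1..n}. minor (omit k t) (column_pairs M))))
    \<approx> (\<Sum>M\<in>Pow {1..n}. minor (s # t) (column_pairs M))"
proof -
  define u where "u k m = a s (2 * m - 1) * a (t ! k) (2 * m)
    - q *s (a s (2 * m) * a (t ! k) (2 * m - 1))" for k m
  define H where "H M m = (\<Sum>x\<in>{2 * m - 1, 2 * m}.
      (- q) ^ below (column_pairs M) x *s (a s x * minor t (column_pairs M - {x})))" for M m
  have tk: "t ! k \<in> {1..N}" "s < t ! k"
      "(\<Sum>M\<in>Pow {1..n}. minor (omit k t) (column_pairs M)) \<in> A" if "k < length t" for k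
  proof -
    show "t ! k \<in> {1..N}" "s < t ! k" using st that by (auto simp: subset_eq)
    show "(\<Sum>M\<in>Pow {1..n}. minor (omit k t) (column_pairs M)) \<in> A"
      using st set_omit[of k t] column_pairs_subset[OF _ n]
      by (intro sum_closed minor_closed) auto
  qed
  have "(\<Sum>k<length t. (- q) ^ k *s (pair_minor_sum n s (t ! k) *
      (\<Sum>M\<in>Pow {1..n}. minor (omit k t) (column_pairs M))))
    \<approx> (\<Sum>k<length t. (- q) ^ k *s ((\<Sum>m = 1..n. u k m) *
      (\<Sum>M\<in>Pow {1..n}. minor (omit k t) (column_pairs M))))"
    unfolding u_def using n st tk by (intro eqv_sum eqv_scale eqv_mult_right pair_minor_sum_eqv) auto
  also have "\<dots> = (\<Sum>M\<in>Pow {1..n}. \<Sum>m = 1..n. \<Sum>k<length t.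
      (- q) ^ k *s (u k m * minor (omit k t) (column_pairs M)))"
  proof -
    have "(\<Sum>k<length t. (- q) ^ k *s ((\<Sum>m = 1..n. u k m) *
        (\<Sum>M\<in>Pow {1..n}. minor (omit k t) (column_pairs M))))
      = (\<Sum>k<length t. \<Sum>M\<in>Pow {1..n}. \<Sum>m = 1..n.
          (- q) ^ k *s (u k m * minor (omit k t) (column_pairs M)))"
      by (simp add: sum_distrib_left sum_distrib_right scale_sum_right)
    also have "\<dots> = (\<Sum>M\<in>Pow {1..n}. \<Sum>k<length t. \<Sum>m = 1..n.
          (- q) ^ k *s (u k m * minor (omit k t) (column_pairs M)))"
      by (rule sum.swap)
    also have "\<dots> = (\<Sum>M\<in>Pow {1..n}. \<Sum>m = 1..n. \<Sum>k<length t.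
          (- q) ^ k *s (u k m * minor (omit k t) (column_pairs M)))"
      by (intro sum.cong refl sum.swap)
    finally show ?thesis .
  qed
  \<comment> \<open>For fixed \<open>M\<close> and \<open>m\<close> the sum over \<open>k\<close>
    consists of two column sums, each with a factor of row \<open>s\<close> in front.\<close>
  also have "\<dots> = (\<Sum>M\<in>Pow {1..n}. \<Sum>m = 1..n.
      a s (2 * m - 1) * column_sum t (2 * m) (column_pairs M)
      - q *s (a s (2 * m) * column_sum t (2 * m - 1) (column_pairs M)))"
    by (simp add: u_def column_sum_def left_diff_distrib scale_right_diff_distrib sum_subtractf
        sum_distrib_left scale_sum_right scale_mult_left scale_mult_right mult.assoc mult.commute[of q])
  also have "\<dots> \<approx> (\<Sum>M\<in>Pow {1..n}. \<Sum>m = 1..n. if m \<in> M then 0 else H (insert m M) m)"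
    unfolding H_def using n st by (intro eqv_sum pair_column_expansion) auto
  also have "\<dots> = (\<Sum>M\<in>Pow {1..n}. \<Sum>m\<in>{1..n} - M. H (insert m M) m)"
    by (intro sum.cong refl sum.mono_neutral_cong_right) auto
  also have "\<dots> = (\<Sum>(M, m)\<in>(SIGMA M:Pow {1..n}. {1..n} - M). H (insert m M) m)"
    by (rule sum.Sigma) auto
  \<comment> \<open>The pairs with \<open>m \<notin> M\<close> correspond to the pairs with
    \<open>m \<in> M\<close> by inserting \<open>m\<close> into \<open>M\<close>, with inverse
    removing it.\<close>
  also have "\<dots> = (\<Sum>(M, m)\<in>(SIGMA M:Pow {1..n}. M). H M m)"
    by (rule sum.reindex_bij_witness[of _ "\<lambda>(M, m). (M - {m}, m)" "\<lambda>(M, m). (insert m M, m)"])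
      (auto simp: insert_absorb)
  also have "\<dots> = (\<Sum>M\<in>Pow {1..n}. \<Sum>m\<in>M. H M m)"
    by (rule sum.Sigma[symmetric]) (auto intro: finite_subset)
  also have "\<dots> = (\<Sum>M\<in>Pow {1..n}. minor (s # t) (column_pairs M))"
    unfolding H_def by (intro sum.cong refl sum_pairs_row_expansion) auto
  finally show ?thesis .
qed

text \<open>A proper subset of \<open>{1..n}\<close> provides fewer than \<open>2 * n\<close>
  columns, so its minor vanishes by \<open>minor_eq_0\<close>.\<close>

lemma sum_minor_column_pairs:
  "(\<Sum>M\<in>Pow {1..n}. minor [1..<Suc (2 * n)] (column_pairs M)) = minor [1..<Suc (2 * n)] {1..2 * n}"
proof -
  have "minor [1..<Suc (2 * n)] (column_pairs M) = 0" if M: "M \<in> Pow {1..n} - {{1..n}}" for M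
  proof (rule minor_eq_0)
    have fin: "finite M" using M finite_subset by auto
    then show "finite (column_pairs M)" by (simp add: column_pairs_def)
    have "card M < n"
      using M psubset_card_mono[of "{1..n}" M] by auto
    moreover have "card (column_pairs M) = 2 * card M"
      using M fin by (intro card_column_pairs) auto
    ultimately show "card (column_pairs M) \<noteq> length [1..<Suc (2 * n)]" by simp
  qed
  then have "(\<Sum>M\<in>Pow {1..n}. minor [1..<Suc (2 * n)] (column_pairs M))
    = (\<Sum>M\<in>{{1..n}}. minor [1..<Suc (2 * n)] (column_pairs M))"
    by (intro sum.mono_neutral_right) auto
  then show ?thesis by (simp add: column_pairs_atLeastAtMost[unfolded One_nat_def])
qed

end

section \<open>The quotient algebra\<close>

text \<open>Scalars are multiples of the empty word, the unit, and hence central although words do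
  not commute. The induction adds one monomial at a time.\<close>

lemma single_0_commute: "Poly_Mapping.single 0 c * p = p * Poly_Mapping.single 0 (c :: complex)"
  for p :: "'x ncpoly"
proof (induction p rule: update_induct)
  case (update p k v)
  have "Poly_Mapping.update k v p = p + Poly_Mapping.single k v"
    using update.hyps
    by (intro poly_mapping_eqI) (auto simp: lookup_update lookup_add lookup_single in_keys_iff)
  then show ?case
    using update.IH by (simp add: distrib_left distrib_right mult_single mult.commute)
qed simp

declare One_nat_def [simp del]

lemma quantum_matrix_free_alg:
  assumes "q \<noteq> 0"
  shows "quantum_matrix (\<lambda>c. Poly_Mapping.map ((*) c)) (carrier (free_alg ({1..N} \<times> {1..N})))
    (qmat_ideal q N) q N (\<lambda>i k. fgen (i, k))"
proof -
  let ?F = "free_alg ({1..N} \<times> {1..N})"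
  interpret I: ideal "qmat_ideal q N" ?F
    by (rule ideal_qmat_ideal)
  have rels: "x \<in> qmat_ideal q N" if "x \<in> qmat_rels q N" for x
    unfolding qmat_ideal_def using that ring.genideal_self[OF ring_free_alg qmat_rels_subset] by blast
  have comm: "x * (Poly_Mapping.single 0 c * y) = Poly_Mapping.single 0 c * (x * y)"
    for c :: complex and x y :: "(nat \<times> nat) ncpoly"
    by (metis mult.assoc single_0_commute)
  have single_0_mult: "Poly_Mapping.single 0 c * (Poly_Mapping.single 0 d * x) = Poly_Mapping.single 0 (c * d) * x"
    for c d :: complex and x :: "(nat \<times> nat) ncpoly"
    by (simp add: mult.assoc[symmetric] mult_single)
  show ?thesis
  proof
    show "0 \<in> qmat_ideal q N" using additive_subgroup.zero_closed[OF I.additive_subgroup_axioms] by simp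
    show "x + y \<in> qmat_ideal q N" if "x \<in> qmat_ideal q N" "y \<in> qmat_ideal q N" for x y
      using additive_subgroup.a_closed[OF I.additive_subgroup_axioms that] by simp
    show "x * y \<in> qmat_ideal q N" if "x \<in> carrier ?F" "y \<in> qmat_ideal q N" for x y
      using I.I_l_closed[OF that(2,1)] by simp
    show "x * y \<in> qmat_ideal q N" if "x \<in> qmat_ideal q N" "y \<in> carrier ?F" for x y
      using I.I_r_closed[OF that] by simp
    show "fgen (i, k) * fgen (j, k) - Poly_Mapping.map ((*) q) (fgen (j, k) * fgen (i, k)) \<in> qmat_ideal q N"
      if "i \<in> {1..N}" "j \<in> {1..N}" "k \<in> {1..N}" "i < j" for i j k
      by (rule rels) (use that in \<open>unfold qmat_rels_def Let_def, blast\<close>)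
    show "fgen (j, k) * fgen (i, l) - fgen (i, l) * fgen (j, k) \<in> qmat_ideal q N"
      if "i \<in> {1..N}" "j \<in> {1..N}" "k \<in> {1..N}" "l \<in> {1..N}" "i < j" "k < l" for i j k l
      by (rule rels) (use that in \<open>unfold qmat_rels_def Let_def, blast\<close>)
    show "fgen (i, k) * fgen (j, l) - fgen (j, l) * fgen (i, k)
        - Poly_Mapping.map ((*) (q - inverse q)) (fgen (i, l) * fgen (j, k)) \<in> qmat_ideal q N"
      if "i \<in> {1..N}" "j \<in> {1..N}" "k \<in> {1..N}" "l \<in> {1..N}" "i < j" "k < l" for i j k l
      by (rule rels) (use that in \<open>unfold qmat_rels_def Let_def, blast\<close>)
    show "0 \<in> carrier ?F" by (simp add: free_alg_carrier)
    show "1 \<in> carrier ?F" by (simp add: free_alg_carrier zero_fword_def)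
    show "Poly_Mapping.map ((*) c) x \<in> carrier ?F" if "x \<in> carrier ?F" for c x
      using that by (rule free_alg_smult_closed)
    show "x * Poly_Mapping.map ((*) c) y = Poly_Mapping.map ((*) c) (x * y)"
      for c :: complex and x y :: "(nat \<times> nat) ncpoly"
      unfolding smult_ncpoly by (rule comm)
  qed (use assms in \<open>auto simp: smult_ncpoly distrib_left distrib_right single_add single_0_mult
      mult.assoc fgen_closed free_alg_closed\<close>)
qed

section \<open>Passage to cosets\<close>

locale qmat_quotient =
  fixes q :: complex and N :: nat
  assumes nonzero: "q \<noteq> 0"
begin

abbreviation "F \<equiv> free_alg ({1..N} \<times> {1..N})"
abbreviation "Mq \<equiv> qmat_alg q N"

definition coset :: "(nat \<times> nat) ncpoly \<Rightarrow> (nat \<times> nat) ncpoly set" where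
  "coset x = qmat_ideal q N +>\<^bsub>F\<^esub> x"

sublocale QM: quantum_matrix "\<lambda>c. Poly_Mapping.map ((*) c)" "carrier F" "qmat_ideal q N" q N
    "\<lambda>i k. fgen (i, k)"
  by (rule quantum_matrix_free_alg) (rule nonzero)

sublocale Q: ring Mq
  by (rule ring_qmat_alg)

sublocale I: ideal "qmat_ideal q N" F
  by (rule ideal_qmat_ideal)

lemma hom: "coset \<in> ring_hom F Mq"
  using I.rcos_ring_hom unfolding ring_hom_def by (simp add: coset_def[abs_def] qmat_alg_def)

lemma coset_closed [simp]: "x \<in> carrier F \<Longrightarrow> coset x \<in> carrier Mq"
  using hom by (rule ring_hom_closed)

lemma coset_one: "coset 1 = \<one>\<^bsub>Mq\<^esub>"
  using ring_hom_one[OF hom] by simp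

lemma coset_add: "x \<in> carrier F \<Longrightarrow> y \<in> carrier F \<Longrightarrow> coset (x + y) = coset x \<oplus>\<^bsub>Mq\<^esub> coset y"
  using ring_hom_add[OF hom, of x y] by simp

lemma coset_mult: "x \<in> carrier F \<Longrightarrow> y \<in> carrier F \<Longrightarrow> coset (x * y) = coset x \<otimes>\<^bsub>Mq\<^esub> coset y"
  using ring_hom_mult[OF hom, of x y] by simp

lemma coset_zero: "coset 0 = \<zero>\<^bsub>Mq\<^esub>"
  using ring_hom_zero[OF hom ring_free_alg Q.ring_axioms] by simp

lemma coset_smult: "x \<in> carrier F \<Longrightarrow> coset (Poly_Mapping.map ((*) c) x) = c \<odot>\<^bsub>Mq\<^esub> coset x"
  unfolding coset_def by (subst qmat_alg_smult_coset) simp_all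

lemma coset_diff:
  assumes "x \<in> carrier F" "y \<in> carrier F"
  shows "coset (x - y) = coset x \<ominus>\<^bsub>Mq\<^esub> coset y"
proof -
  have "x - y \<in> carrier F" using assms by (rule free_alg_closed)
  then have "coset x = coset (x - y) \<oplus>\<^bsub>Mq\<^esub> coset y" "coset (x - y) \<in> carrier Mq"
    using coset_add[of "x - y" y] assms by simp_all
  then show ?thesis
    using assms by (simp add: a_minus_def Q.a_assoc Q.r_neg)
qed

lemma coset_sum:
  assumes "finite X" "\<And>x. x \<in> X \<Longrightarrow> f x \<in> carrier F"
  shows "coset (sum f X) = (\<Oplus>\<^bsub>Mq\<^esub>x\<in>X. coset (f x))"
  using assms
proof (induction X rule: finite_induct)
  case (insert x X)
  then show ?case
    by (simp add: coset_add QM.sum_closed)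
qed (simp add: coset_zero)

text \<open>Membership in the carrier is proved together with the product formula because the
  induction step needs both.\<close>

lemma coset_prod_list:
  assumes "\<And>x. x \<in> set xs \<Longrightarrow> f x \<in> carrier F"
  shows "prod_list (map f xs) \<in> carrier F \<and>
    coset (prod_list (map f xs)) = foldr (\<otimes>\<^bsub>Mq\<^esub>) (map (\<lambda>x. coset (f x)) xs) \<one>\<^bsub>Mq\<^esub>"
  using assms
  by (induction xs) (simp_all add: QM.one_closed coset_one QM.mult_closed coset_mult)

lemma coset_eqv:
  assumes "x \<in> carrier F" "y \<in> carrier F" "QM.eqv x y"
  shows "coset x = coset y"
proof -
  \<comment> \<open>Subtraction in the structure is defined by its own additive inverse; cancelling
    \<open>y\<close> in \<open>(x - y) + y\<close> identifies it with subtraction on the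
    type.\<close>
  have "x \<ominus>\<^bsub>F\<^esub> y = x - y"
  proof -
    have "x - y \<in> carrier F" using assms by (intro free_alg_closed)
    then have "(x - y) \<oplus>\<^bsub>F\<^esub> y \<ominus>\<^bsub>F\<^esub> y = x - y"
      using assms by (simp only: a_minus_def I.a_assoc I.r_neg I.a_inv_closed I.r_zero)
    then show ?thesis by simp
  qed
  then show ?thesis
    using assms ring.quotient_eq_iff_same_a_r_cos[OF ring_free_alg ideal_qmat_ideal, of x N y q]
    by (simp add: coset_def QM.eqv_def)
qed

lemma coset_pair_minor_sum:
  assumes "N = 2 * n" "i \<in> {1..N}" "j \<in> {1..N}"
  shows "coset (QM.pair_minor_sum n i j) = qmat_b' q n i j"
proof -
  have gen: "fgen (k, l) \<in> carrier F" if "k \<in> {1..N}" "l \<in> {1..N}" for k l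
    using that by (simp add: fgen_closed)
  have cl: "fgen (i, 2 * m - 1) \<in> carrier F" "fgen (j, 2 * m) \<in> carrier F"
      "fgen (j, 2 * m - 1) \<in> carrier F" "fgen (i, 2 * m) \<in> carrier F" if "m \<in> {1..n}" for m
    using that assms by (intro gen; auto)+
  have [simp]: "coset (fgen (k, l)) = qmat_gen q N k l" for k l
    by (simp add: coset_def qmat_gen_def)
  have "coset (QM.pair_minor_sum n i j) = (\<Oplus>\<^bsub>Mq\<^esub>m\<in>{1..n}. coset (fgen (i, 2 * m - 1) * fgen (j, 2 * m)
      - Poly_Mapping.map ((*) q) (fgen (j, 2 * m - 1) * fgen (i, 2 * m))))"
    unfolding QM.pair_minor_sum_def
    by (rule coset_sum) (use cl in \<open>auto intro!: QM.minus_closed QM.mult_closed QM.scale_closed\<close>)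
  also have "\<dots> = (\<Oplus>\<^bsub>Mq\<^esub>m\<in>{1..n}. qmat_gen q N i (2 * m - 1) \<otimes>\<^bsub>Mq\<^esub> qmat_gen q N j (2 * m)
        \<ominus>\<^bsub>Mq\<^esub> q \<odot>\<^bsub>Mq\<^esub> (qmat_gen q N j (2 * m - 1) \<otimes>\<^bsub>Mq\<^esub> qmat_gen q N i (2 * m)))"
  proof -
    have *: "coset (fgen (i, 2 * m - 1) * fgen (j, 2 * m)
          - Poly_Mapping.map ((*) q) (fgen (j, 2 * m - 1) * fgen (i, 2 * m)))
        = qmat_gen q N i (2 * m - 1) \<otimes>\<^bsub>Mq\<^esub> qmat_gen q N j (2 * m)
        \<ominus>\<^bsub>Mq\<^esub> q \<odot>\<^bsub>Mq\<^esub> (qmat_gen q N j (2 * m - 1) \<otimes>\<^bsub>Mq\<^esub> qmat_gen q N i (2 * m))"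
      if "m \<in> {1..n}" for m
      using cl[OF that]
      by (simp add: coset_diff coset_smult coset_mult QM.mult_closed QM.scale_closed)
    show ?thesis
    proof (rule Q.finsum_cong'[OF refl])
      show "(\<lambda>m. qmat_gen q N i (2 * m - 1) \<otimes>\<^bsub>Mq\<^esub> qmat_gen q N j (2 * m)
        \<ominus>\<^bsub>Mq\<^esub> q \<odot>\<^bsub>Mq\<^esub> (qmat_gen q N j (2 * m - 1) \<otimes>\<^bsub>Mq\<^esub> qmat_gen q N i (2 * m))) \<in> {1..n} \<rightarrow> carrier Mq"
      proof (rule Pi_I)
        fix m assume m: "m \<in> {1..n}"
        \<comment> \<open>Membership in the carrier is read off from a representative in
          \<open>F\<close>.\<close>
        show "qmat_gen q N i (2 * m - 1) \<otimes>\<^bsub>Mq\<^esub> qmat_gen q N j (2 * m)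
          \<ominus>\<^bsub>Mq\<^esub> q \<odot>\<^bsub>Mq\<^esub> (qmat_gen q N j (2 * m - 1) \<otimes>\<^bsub>Mq\<^esub> qmat_gen q N i (2 * m)) \<in> carrier Mq"
          unfolding *[OF m, symmetric]
          by (intro coset_closed QM.minus_closed QM.mult_closed QM.scale_closed cl m)
      qed
    qed (rule *)
  qed
  finally show ?thesis
    by (simp add: qmat_b'_def Let_def assms(1))
qed

section \<open>Identification of the bracket and of the determinant\<close>

text \<open>By \<open>pfaffian_step\<close> the sums of minors satisfy the recursion of the bracket,
  so strong induction on the length applies.\<close>

lemma qbracket_eq_coset:
  assumes n: "N = 2 * n" and "sorted_wrt (<) S" "set S \<subseteq> {1..N}" "even (length S)"
  shows "qbracket Mq q (qmat_b' q n) S = coset (\<Sum>C\<in>Pow {1..n}. QM.minor S (column_pairs C))"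
proof -
  define G where "G S = (\<Sum>C\<in>Pow {1..n}. QM.minor S (column_pairs C))" for S
  have G_closed: "G S \<in> carrier F" if "set S \<subseteq> {1..N}" for S
    unfolding G_def using that column_pairs_subset[of _ n N] n
    by (intro QM.sum_closed QM.minor_closed) auto
  have b_closed: "QM.pair_minor_sum n i j \<in> carrier F" if "i \<in> {1..N}" "j \<in> {1..N}" for i j
    using QM.pair_minor_sum_closed[of n i j] n that by simp
  \<comment> \<open>Every pair of columns is nonempty, so only the empty index set gives the empty
    minor.\<close>
  have G_Nil: "G [] = 1"
  proof -
    have "column_pairs C = {} \<longleftrightarrow> C = {}" for C
      by (auto simp: column_pairs_def)
    then show ?thesis by (simp add: G_def)
  qed
  have term_closed: "(- q) ^ k \<odot>\<^bsub>Mq\<^esub> (qmat_b' q n s (t ! k) \<otimes>\<^bsub>Mq\<^esub> coset (G (omit k t))) \<in> carrier Mq"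
    if st: "set (s # t) \<subseteq> {1..N}" and k: "k < length t" for s t k
  proof -
    have sk: "s \<in> {1..N}" "t ! k \<in> {1..N}" using st k by (auto simp: subset_eq)
    have G: "G (omit k t) \<in> carrier F" using st set_omit[of k t] by (intro G_closed) auto
    have "coset (Poly_Mapping.map ((*) ((- q) ^ k)) (QM.pair_minor_sum n s (t ! k) * G (omit k t))) \<in> carrier Mq"
      by (intro coset_closed QM.scale_closed QM.mult_closed b_closed sk G)
    then show ?thesis
      by (simp only: coset_smult coset_mult QM.mult_closed b_closed sk G coset_pair_minor_sum[OF n sk])
  qed
  have G_Cons: "coset (G (s # t)) = (\<Oplus>\<^bsub>Mq\<^esub>k\<in>{..<length t}.
      (- q) ^ k \<odot>\<^bsub>Mq\<^esub> (qmat_b' q n s (t ! k) \<otimes>\<^bsub>Mq\<^esub> coset (G (omit k t))))"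
    if st: "sorted_wrt (<) (s # t)" "set (s # t) \<subseteq> {1..N}" for s t
  proof -
    have cl: "QM.pair_minor_sum n s (t ! k) \<in> carrier F" "G (omit k t) \<in> carrier F"
      "coset (QM.pair_minor_sum n s (t ! k)) = qmat_b' q n s (t ! k)"
      if "k < length t" for k
    proof -
      have "s \<in> {1..N}" "t ! k \<in> {1..N}" using st that by (auto simp: subset_eq)
      then show "QM.pair_minor_sum n s (t ! k) \<in> carrier F"
        "coset (QM.pair_minor_sum n s (t ! k)) = qmat_b' q n s (t ! k)"
        by (rule b_closed, rule coset_pair_minor_sum[OF n])
      show "G (omit k t) \<in> carrier F"
        using st set_omit[of k t] by (intro G_closed) auto
    qed
    have "coset (G (s # t)) = coset (\<Sum>k<length t. Poly_Mapping.map ((*) ((- q) ^ k))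
        (QM.pair_minor_sum n s (t ! k) * G (omit k t)))"
    proof (rule coset_eqv)
      show "G (s # t) \<in> carrier F" using st(2) by (rule G_closed)
      show "(\<Sum>k<length t. Poly_Mapping.map ((*) ((- q) ^ k))
          (QM.pair_minor_sum n s (t ! k) * G (omit k t))) \<in> carrier F"
        using cl by (intro QM.sum_closed QM.scale_closed QM.mult_closed) simp_all
      show "QM.eqv (G (s # t)) (\<Sum>k<length t. Poly_Mapping.map ((*) ((- q) ^ k))
          (QM.pair_minor_sum n s (t ! k) * G (omit k t)))"
        unfolding G_def by (rule QM.eqv_sym, rule QM.pfaffian_step) (use n st in simp_all)
    qed
    also have "\<dots> = (\<Oplus>\<^bsub>Mq\<^esub>k\<in>{..<length t}. coset (Poly_Mapping.map ((*) ((- q) ^ k))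
        (QM.pair_minor_sum n s (t ! k) * G (omit k t))))"
      using cl by (intro coset_sum QM.scale_closed QM.mult_closed) auto
    also have "\<dots> = (\<Oplus>\<^bsub>Mq\<^esub>k\<in>{..<length t}.
      (- q) ^ k \<odot>\<^bsub>Mq\<^esub> (qmat_b' q n s (t ! k) \<otimes>\<^bsub>Mq\<^esub> coset (G (omit k t))))"
    proof -
      have *: "coset (Poly_Mapping.map ((*) ((- q) ^ k)) (QM.pair_minor_sum n s (t ! k) * G (omit k t)))
        = (- q) ^ k \<odot>\<^bsub>Mq\<^esub> (qmat_b' q n s (t ! k) \<otimes>\<^bsub>Mq\<^esub> coset (G (omit k t)))"
        if "k \<in> {..<length t}" for k
        using that cl[of k] by (simp add: coset_smult coset_mult QM.mult_closed)
      show ?thesis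
        by (rule Q.finsum_cong'[OF refl _ *], rule Pi_I, rule term_closed[OF st(2)], simp_all)
    qed
    finally show ?thesis .
  qed
  have singleton: "(\<Oplus>\<^bsub>Mq\<^esub>k\<in>{0}. f k) = f 0" if "f 0 \<in> carrier Mq" for f :: "nat \<Rightarrow> _"
    using Q.finsum_insert[of "{}" 0 f] that by simp
  have "qbracket Mq q (qmat_b' q n) S = coset (G S)"
    using assms(2-4)
  proof (induction S rule: length_induct)
    case (1 S)
    \<comment> \<open>Even length excludes the singleton, where \<open>qbracket\<close> has a
      default value.\<close>
    consider "S = []" | i j where "S = [i, j]" | s t1 t2 ts where "S = s # t1 # t2 # ts"
      using \<open>even (length S)\<close> by (cases S; cases "tl S"; cases "tl (tl S)") auto
    then show ?case
    proof cases
      case 1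
      then show ?thesis by (simp add: G_Nil coset_one)
    next
      case (2 i j)
      then have ij: "i \<in> {1..N}" "j \<in> {1..N}"
        using "1.prems" by auto
      note b = b_closed[OF ij] coset_pair_minor_sum[OF n ij]
      \<comment> \<open>\<open>qbracket\<close> has a separate clause for two entries; for
        \<open>G\<close> it is the general recursion with the single index 0 and
        \<open>G [] = 1\<close>.\<close>
      have "coset (G [i, j]) = 1 \<odot>\<^bsub>Mq\<^esub> (qmat_b' q n i j \<otimes>\<^bsub>Mq\<^esub> coset 1)"
      proof -
        have "coset (G [i, j]) = (\<Oplus>\<^bsub>Mq\<^esub>k\<in>{0}.
            (- q) ^ k \<odot>\<^bsub>Mq\<^esub> (qmat_b' q n i ([j] ! k) \<otimes>\<^bsub>Mq\<^esub> coset (G (omit k [j]))))"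
          using "1.prems" 2 by (subst G_Cons) (simp_all add: lessThan_Suc)
        also have "\<dots> = (- q) ^ 0 \<odot>\<^bsub>Mq\<^esub> (qmat_b' q n i ([j] ! 0) \<otimes>\<^bsub>Mq\<^esub> coset (G (omit 0 [j])))"
          using term_closed[of i "[j]" 0] ij by (intro singleton) simp
        finally show ?thesis by (simp add: G_Nil)
      qed
      also have "\<dots> = coset (Poly_Mapping.map ((*) 1) (QM.pair_minor_sum n i j * 1))"
        unfolding b(2)[symmetric] using b(1)
        by (simp only: coset_smult coset_mult QM.mult_closed QM.one_closed)
      also have "\<dots> = qmat_b' q n i j"
        unfolding b(2)[symmetric] QM.scale_one by simp
      finally show ?thesis using 2 by simp
    next
      case (3 s t1 t2 ts)
      define t where "t = t1 # t2 # ts"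
      have S: "S = s # t" using 3 by (simp add: t_def)
      \<comment> \<open>Dropping \<open>s\<close> and one entry of \<open>t\<close> preserves strict
        order and the parity of the length.\<close>
      have omit: "qbracket Mq q (qmat_b' q n) (omit k t) = coset (G (omit k t))" if "k < length t" for k
      proof -
        have "sorted_wrt (<) (omit k t)" "set (omit k t) \<subseteq> {1..N}"
          using "1.prems" S sorted_wrt_omit[of "(<)" t k] set_omit[of k t] by auto
        moreover have "length (omit k t) < length S" "even (length (omit k t))"
          using "1.prems" S that by (auto simp: length_omit)
        ultimately show ?thesis using "1.IH" by (simp only: simp_thms)
      qed
      have "qbracket Mq q (qmat_b' q n) S = (\<Oplus>\<^bsub>Mq\<^esub>k\<in>{..<length t}.
          (- q) ^ k \<odot>\<^bsub>Mq\<^esub> (qmat_b' q n s (t ! k) \<otimes>\<^bsub>Mq\<^esub> qbracket Mq q (qmat_b' q n) (omit k t)))"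
        unfolding 3 t_def omit_def qbracket.simps(4) Let_def ..
      also have "\<dots> = coset (G S)"
      proof -
        have st: "sorted_wrt (<) (s # t)" "set (s # t) \<subseteq> {1..N}" using "1.prems" S by simp_all
        show ?thesis
          unfolding S G_Cons[OF st]
          by (rule Q.finsum_cong'[OF refl], rule Pi_I, rule term_closed[OF st(2)])
            (simp_all add: omit)
      qed
      finally show ?thesis .
    qed
  qed
  then show ?thesis by (simp add: G_def)
qed

text \<open>The coset map passes through the sum, the scalars and the ordered products of the
  permutation expansion.\<close>

lemma coset_minor:
  "coset (QM.minor [1..<Suc N] {1..N}) = qdet Mq q N (qmat_gen q N)"
proof -
  have prod: "prod_list (map (\<lambda>i. fgen (i, \<sigma> i)) [1..<Suc N]) \<in> carrier F \<and>
    coset (prod_list (map (\<lambda>i. fgen (i, \<sigma> i)) [1..<Suc N]))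
      = foldr (\<otimes>\<^bsub>Mq\<^esub>) (map (\<lambda>i. qmat_gen q N i (\<sigma> i)) [1..<Suc N]) \<one>\<^bsub>Mq\<^esub>"
    if "\<sigma> permutes {1..N}" for \<sigma>
  proof -
    have "fgen (i, \<sigma> i) \<in> carrier F" if "i \<in> set [1..<Suc N]" for i
      using that permutes_in_image[OF \<open>\<sigma> permutes {1..N}\<close>, of i] by (auto simp: fgen_closed)
    from coset_prod_list[OF this] show ?thesis
      by (simp only: coset_def qmat_gen_def)
  qed
  have "coset (QM.minor [1..<Suc N] {1..N}) = (\<Oplus>\<^bsub>Mq\<^esub>\<sigma>\<in>{\<sigma>. \<sigma> permutes {1..N}}.
      coset (Poly_Mapping.map ((*) ((- q) ^ card (inversions N \<sigma>)))
        (prod_list (map (\<lambda>i. fgen (i, \<sigma> i)) [1..<Suc N]))))"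
    unfolding QM.minor_eq_sum_permutes using prod
    by (intro coset_sum finite_permutations QM.scale_closed) auto
  also have "\<dots> = qdet Mq q N (qmat_gen q N)"
    unfolding qdet_def
  proof (rule Q.finsum_cong'[OF refl])
    have *: "coset (Poly_Mapping.map ((*) ((- q) ^ card (inversions N \<sigma>)))
        (prod_list (map (\<lambda>i. fgen (i, \<sigma> i)) [1..<Suc N])))
      = (- q) ^ card (inversions N \<sigma>) \<odot>\<^bsub>Mq\<^esub>
        foldr (\<otimes>\<^bsub>Mq\<^esub>) (map (\<lambda>i. qmat_gen q N i (\<sigma> i)) [1..<Suc N]) \<one>\<^bsub>Mq\<^esub>"
      if "\<sigma> \<in> {\<sigma>. \<sigma> permutes {1..N}}" for \<sigma>
      using prod[of \<sigma>] that by (simp only: coset_smult mem_Collect_eq)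
    show "coset (Poly_Mapping.map ((*) ((- q) ^ card (inversions N \<sigma>)))
        (prod_list (map (\<lambda>i. fgen (i, \<sigma> i)) [1..<Suc N])))
      = (- q) ^ card (inversions N \<sigma>) \<odot>\<^bsub>Mq\<^esub>
        foldr (\<otimes>\<^bsub>Mq\<^esub>) (map (\<lambda>i. qmat_gen q N i (\<sigma> i)) [1..<Suc N]) \<one>\<^bsub>Mq\<^esub>"
      if "\<sigma> \<in> {\<sigma>. \<sigma> permutes {1..N}}" for \<sigma>
      using that by (rule *)
    show "(\<lambda>\<sigma>. (- q) ^ card (inversions N \<sigma>) \<odot>\<^bsub>Mq\<^esub>
        foldr (\<otimes>\<^bsub>Mq\<^esub>) (map (\<lambda>i. qmat_gen q N i (\<sigma> i)) [1..<Suc N]) \<one>\<^bsub>Mq\<^esub>)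
      \<in> {\<sigma>. \<sigma> permutes {1..N}} \<rightarrow> carrier Mq"
    proof (rule Pi_I)
      fix \<sigma> assume \<sigma>: "\<sigma> \<in> {\<sigma>. \<sigma> permutes {1..N}}"
      show "(- q) ^ card (inversions N \<sigma>) \<odot>\<^bsub>Mq\<^esub>
          foldr (\<otimes>\<^bsub>Mq\<^esub>) (map (\<lambda>i. qmat_gen q N i (\<sigma> i)) [1..<Suc N]) \<one>\<^bsub>Mq\<^esub> \<in> carrier Mq"
        unfolding *[OF \<sigma>, symmetric] using prod[of \<sigma>] \<sigma> by (intro coset_closed QM.scale_closed) auto
    qed
  qed
  finally show ?thesis .
qed

end

theorem theorem2p14:
  fixes q :: complex and n :: nat
  assumes "q \<noteq> 0" and "n \<ge> 1"
  shows "qpfaffian (qmat_alg q (2 * n)) q n (qmat_b' q n)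
       = qdet (qmat_alg q (2 * n)) q (2 * n) (qmat_gen q (2 * n))"
proof -
  interpret qmat_quotient q "2 * n"
    using assms(1) by unfold_locales
  have "qpfaffian (qmat_alg q (2 * n)) q n (qmat_b' q n)
    = coset (\<Sum>C\<in>Pow {1..n}. QM.minor [1..<Suc (2 * n)] (column_pairs C))"
    unfolding qpfaffian_def
    by (rule qbracket_eq_coset[OF refl]) (auto simp del: upt_Suc)
  also have "\<dots> = qdet (qmat_alg q (2 * n)) q (2 * n) (qmat_gen q (2 * n))"
    unfolding QM.sum_minor_column_pairs by (rule coset_minor)
  finally show ?thesis .
qed

end
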